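(* Let $A$, $B$ be bialgebras and let $\mathcal F\in\operatorname{Hom}_\Bbbk(B\otimes A,\Bbbk)$ be a relative dual Drinfeld twist. Let $U$ be a unital algebra with multiplication $m_U:U\otimes U\to U$ and let $\varphi_A:A\to U$, $\varphi_B:B\to U$ be homomorphisms of unital algebras. Then $m_U\circ(\varphi_A\otimes\varphi_B)$ is a homomorphism of algebras $(A\otimes B,\bullet_{\mathcal F_{2,3}})\to U$ if and only if $$\mathcal F(b_{(1)},a_{(1)})\varphi_B(b_{(2)})\varphi_A(a_{(2)})=\mathcal F(b_{(2)},a_{(2)})\varphi_A(a_{(1)})\varphi_B(b_{(1)}),\qquad a\in A,\ b\in B.$$
   Context: $\Bbbk$ is a field of characteristic zero; Sweedler notation is used. For a coalgebra $D$, the convolution on $\operatorname{Hom}_\Bbbk(D,\Bbbk)$ is $(f*g)(d)=f(d_{(1)})g(d_{(2)})$ with unit $\varepsilon$; $f^{*-1}$ is the convolution inverse. A dual Drinfeld twist for a bialgebra $D$ (with multiplication $m_D$) is a $*$-invertible $\mathcal J\in\operatorname{Hom}_\Bbbk(D\otimes D,\Bbbk)$ such that $\mathcal J(a_{(1)},1)a_{(2)}=\mathcal J(a_{(2)},1)a_{(1)}$ and $\mathcal J(1,a_{(1)})a_{(2)}=\mathcal J(1,a_{(2)})a_{(1)}$ for all $a\in D$, and $(\mathcal J\circ(m_D\otimes\mathrm{id}))*\mathcal J_{1,2}=(\mathcal J\circ(\mathrm{id}\otimes m_D))*\mathcal J_{2,3}$ in $\operatorname{Hom}_\Bbbk(D^{\otimes3},\Bbbk)$,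 where $\mathcal J_{1,2}(x\otimes y\otimes z)=\mathcal J(x,y)\varepsilon(z)$ and $\mathcal J_{2,3}(x\otimes y\otimes z)=\varepsilon(x)\mathcal J(y,z)$. The twisted multiplication on $D$ is $x\bullet_{\mathcal J}y=\mathcal J^{*-1}(x_{(1)},y_{(1)})\,\mathcal J(x_{(3)},y_{(3)})\,x_{(2)}y_{(2)}$. For $\mathcal F\in\operatorname{Hom}_\Bbbk(B\otimes A,\Bbbk)$, $\mathcal F_{2,3}\in\operatorname{Hom}_\Bbbk((A\otimes B)^{\otimes2},\Bbbk)$ is $\mathcal F_{2,3}(a\otimes b\otimes a'\otimes b')=\varepsilon(a)\mathcal F(b,a')\varepsilon(b')$. $\mathcal F$ is a relative dual Drinfeld twist if $\mathcal F_{2,3}$ is a dual Drinfeld twist for the bialgebra $A\otimes B$ (with its standard tensor product structure). *)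

theory Defs
  imports "HOL-Algebra.Module" "HOL-Library.Poly_Mapping"
begin

text \<open>
  The ground field is the type \<open>'k\<close>; vector spaces over it are carrier-based modules
  (\<open>HOL-Algebra\<close>) over the following record, which is also the ground field regarded as an
  algebra over itself. Because \<open>HOL-Algebra\<close> writes the product of an algebra as
  \<open>\<otimes>\<close>, the tensor of two elements is written \<open>tensor\<close>.
\<close>

definition ground :: "('k::field, 'k) module" where
  "ground = \<lparr>carrier = UNIV, mult = (*), one = 1, zero = 0, add = (+), smult = (*)\<rparr>"

abbreviation vspace :: "('k::field, 'a, 'm) module_scheme \<Rightarrow> bool" where
  "vspace V \<equiv> Module.module ground V"

definition linear_map ::
    "('k::field, 'a, 'm) module_scheme \<Rightarrow> ('k, 'b, 'n) module_scheme \<Rightarrow> ('a \<Rightarrow> 'b) \<Rightarrow> bool" where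
  "linear_map V W f \<longleftrightarrow>
     f \<in> carrier V \<rightarrow> carrier W \<and>
     (\<forall>x\<in>carrier V. \<forall>y\<in>carrier V. f (x \<oplus>\<^bsub>V\<^esub> y) = f x \<oplus>\<^bsub>W\<^esub> f y) \<and>
     (\<forall>c. \<forall>x\<in>carrier V. f (c \<odot>\<^bsub>V\<^esub> x) = c \<odot>\<^bsub>W\<^esub> f x)"

text \<open>Unlike the library locale \<open>algebra\<close>, this does not require commutativity.\<close>

definition unital_algebra :: "('k::field, 'a, 'm) module_scheme \<Rightarrow> bool" where
  "unital_algebra A \<longleftrightarrow> vspace A \<and> ring A \<and>
     (\<forall>c. \<forall>x\<in>carrier A. \<forall>y\<in>carrier A.
        (c \<odot>\<^bsub>A\<^esub> x) \<otimes>\<^bsub>A\<^esub> y = c \<odot>\<^bsub>A\<^esub> (x \<otimes>\<^bsub>A\<^esub> y) \<and>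
        x \<otimes>\<^bsub>A\<^esub> (c \<odot>\<^bsub>A\<^esub> y) = c \<odot>\<^bsub>A\<^esub> (x \<otimes>\<^bsub>A\<^esub> y))"

definition algebra_hom ::
    "('k::field, 'a, 'm) module_scheme \<Rightarrow> ('k, 'b, 'n) module_scheme \<Rightarrow> ('a \<Rightarrow> 'b) \<Rightarrow> bool" where
  "algebra_hom A B f \<longleftrightarrow> linear_map A B f \<and> f \<in> ring_hom A B"


section \<open>Tensor products\<close>

text \<open>
  \<open>V \<otimes> W\<close> is the free vector space on \<open>carrier V \<times> carrier W\<close> (finitely supported functions)
  modulo the subspace generated by the bilinearity relations; its elements are cosets.
\<close>

type_synonym ('k, 'a, 'b) tens = "('a \<times> 'b \<Rightarrow>\<^sub>0 'k) set"

definition fscale :: "'k::field \<Rightarrow> ('x \<Rightarrow>\<^sub>0 'k) \<Rightarrow> ('x \<Rightarrow>\<^sub>0 'k)" where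
  "fscale c f = Poly_Mapping.map ((*) c) f"

abbreviation gen :: "'a \<Rightarrow> 'b \<Rightarrow> ('a \<times> 'b \<Rightarrow>\<^sub>0 'k::field)" where
  "gen x y \<equiv> Poly_Mapping.single (x, y) 1"

inductive_set tensor_null ::
    "('k::field, 'a, 'm) module_scheme \<Rightarrow> ('k, 'b, 'n) module_scheme \<Rightarrow> ('k, 'a, 'b) tens"
  for V :: "('k::field, 'a, 'm) module_scheme" and W :: "('k, 'b, 'n) module_scheme" where
  zero: "0 \<in> tensor_null V W"
| add: "f \<in> tensor_null V W \<Longrightarrow> g \<in> tensor_null V W \<Longrightarrow> f + g \<in> tensor_null V W"
| scale: "f \<in> tensor_null V W \<Longrightarrow> fscale c f \<in> tensor_null V W"
| add_left: "x \<in> carrier V \<Longrightarrow> x' \<in> carrier V \<Longrightarrow> y \<in> carrier W \<Longrightarrow>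
    gen (x \<oplus>\<^bsub>V\<^esub> x') y - gen x y - gen x' y \<in> tensor_null V W"
| add_right: "x \<in> carrier V \<Longrightarrow> y \<in> carrier W \<Longrightarrow> y' \<in> carrier W \<Longrightarrow>
    gen x (y \<oplus>\<^bsub>W\<^esub> y') - gen x y - gen x y' \<in> tensor_null V W"
| smult_left: "x \<in> carrier V \<Longrightarrow> y \<in> carrier W \<Longrightarrow>
    gen (c \<odot>\<^bsub>V\<^esub> x) y - fscale c (gen x y) \<in> tensor_null V W"
| smult_right: "x \<in> carrier V \<Longrightarrow> y \<in> carrier W \<Longrightarrow>
    gen x (c \<odot>\<^bsub>W\<^esub> y) - fscale c (gen x y) \<in> tensor_null V W"

definition tensor_class ::
    "('k::field, 'a, 'm) module_scheme \<Rightarrow> ('k, 'b, 'n) module_scheme \<Rightarrow> ('a \<times> 'b \<Rightarrow>\<^sub>0 'k)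
      \<Rightarrow> ('k, 'a, 'b) tens" where
  "tensor_class V W f = {g. g - f \<in> tensor_null V W}"

definition tensor ::
    "('k::field, 'a, 'm) module_scheme \<Rightarrow> ('k, 'b, 'n) module_scheme \<Rightarrow> 'a \<Rightarrow> 'b
      \<Rightarrow> ('k, 'a, 'b) tens" where
  "tensor V W x y = tensor_class V W (gen x y)"

text \<open>
  The \<open>mult\<close> and \<open>one\<close> fields are placeholders: here only the vector space structure is meant.
  The product of a tensor product of algebras is supplied by \<open>tensor_algebra\<close> below.
\<close>

definition tensor_space ::
    "('k::field, 'a, 'm) module_scheme \<Rightarrow> ('k, 'b, 'n) module_scheme
      \<Rightarrow> ('k, ('k, 'a, 'b) tens) module" where
  "tensor_space V W =
     \<lparr>carrier = {tensor_class V W f | f. Poly_Mapping.keys f \<subseteq> carrier V \<times> carrier W},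
      mult = undefined, one = undefined,
      zero = tensor_null V W,
      add = (\<lambda>X Y. {f + g | f g. f \<in> X \<and> g \<in> Y}),
      smult = (\<lambda>c X. {fscale c f + n | f n. f \<in> X \<and> n \<in> tensor_null V W})\<rparr>"

text \<open>
  The linear map \<open>V \<otimes> W \<rightarrow> Z\<close> induced by a bilinear map \<open>\<beta> : V \<times> W \<rightarrow> Z\<close>, that is
  \<open>\<Sum>\<^sub>i c\<^sub>i (x\<^sub>i \<otimes> y\<^sub>i) \<mapsto> \<Sum>\<^sub>i c\<^sub>i \<beta>(x\<^sub>i, y\<^sub>i)\<close>. For bilinear \<open>\<beta>\<close> (the only case used) all
  representatives of a coset give the same value, so the image below is a singleton.
\<close>

definition lift :: "('k::field, 'z, 'n) module_scheme \<Rightarrow> ('a \<Rightarrow> 'b \<Rightarrow> 'z) \<Rightarrow> ('k, 'a, 'b) tens \<Rightarrow> 'z" where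
  "lift Z \<beta> X = the_elem
     ((\<lambda>f. \<Oplus>\<^bsub>Z\<^esub>p\<in>Poly_Mapping.keys f. Poly_Mapping.lookup f p \<odot>\<^bsub>Z\<^esub> \<beta> (fst p) (snd p)) ` X)"

text \<open>The same for a trilinear map, on \<open>(V \<otimes> V') \<otimes> V''\<close>.\<close>

definition lift3 :: "('k::field, 'z, 'n) module_scheme \<Rightarrow> ('a \<Rightarrow> 'b \<Rightarrow> 'c \<Rightarrow> 'z)
    \<Rightarrow> ('k, ('k, 'a, 'b) tens, 'c) tens \<Rightarrow> 'z" where
  "lift3 Z \<beta> = lift Z (\<lambda>t z. lift Z (\<lambda>x y. \<beta> x y z) t)"

text \<open>The linear map \<open>f \<otimes> g\<close> with values in \<open>V \<otimes> W\<close>.\<close>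

definition tensor_map ::
    "('k::field, 'c, 'm) module_scheme \<Rightarrow> ('k, 'd, 'n) module_scheme
      \<Rightarrow> ('a \<Rightarrow> 'c) \<Rightarrow> ('b \<Rightarrow> 'd) \<Rightarrow> ('k, 'a, 'b) tens \<Rightarrow> ('k, 'c, 'd) tens" where
  "tensor_map V W f g = lift (tensor_space V W) (\<lambda>x y. tensor V W (f x) (g y))"

definition tensor_algebra ::
    "('k::field, 'a, 'm) module_scheme \<Rightarrow> ('k, 'b, 'n) module_scheme
      \<Rightarrow> ('k, ('k, 'a, 'b) tens) module" where
  "tensor_algebra A B = (tensor_space A B)
     \<lparr>mult := (\<lambda>X Y. lift (tensor_space A B) (\<lambda>a b. lift (tensor_space A B)
                (\<lambda>a' b'. tensor A B (a \<otimes>\<^bsub>A\<^esub> a') (b \<otimes>\<^bsub>B\<^esub> b')) Y) X),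
      one := tensor A B \<one>\<^bsub>A\<^esub> \<one>\<^bsub>B\<^esub>\<rparr>"

text \<open>The multiplication of an algebra as a linear map \<open>A \<otimes> A \<rightarrow> A\<close>.\<close>

definition mult_map :: "('k::field, 'a, 'm) module_scheme \<Rightarrow> ('k, 'a, 'a) tens \<Rightarrow> 'a" where
  "mult_map A = lift A (\<lambda>x y. x \<otimes>\<^bsub>A\<^esub> y)"


section \<open>Bialgebras\<close>

record (overloaded) ('k::zero, 'a) bialg = "('k, 'a) module" +
  comult :: "'a \<Rightarrow> ('k, 'a, 'a) tens"
  counit :: "'a \<Rightarrow> 'k"

text \<open>
  Sweedler notation: \<open>sweedler2 D Z \<beta> d\<close> is \<open>\<beta>(d\<^sub>(\<^sub>1\<^sub>), d\<^sub>(\<^sub>2\<^sub>))\<close> for \<open>\<beta>\<close> bilinear with values in \<open>Z\<close>,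
  and \<open>sweedler3 D Z \<beta> d\<close> is \<open>\<beta>(d\<^sub>(\<^sub>1\<^sub>), d\<^sub>(\<^sub>2\<^sub>), d\<^sub>(\<^sub>3\<^sub>))\<close> for \<open>\<beta>\<close> trilinear.
\<close>

definition sweedler2 :: "('k::field, 'a, 'm) bialg_scheme \<Rightarrow> ('k, 'z, 'n) module_scheme
    \<Rightarrow> ('a \<Rightarrow> 'a \<Rightarrow> 'z) \<Rightarrow> 'a \<Rightarrow> 'z" where
  "sweedler2 D Z \<beta> d = lift Z \<beta> (comult D d)"

definition sweedler3 :: "('k::field, 'a, 'm) bialg_scheme \<Rightarrow> ('k, 'z, 'n) module_scheme
    \<Rightarrow> ('a \<Rightarrow> 'a \<Rightarrow> 'a \<Rightarrow> 'z) \<Rightarrow> 'a \<Rightarrow> 'z" where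
  "sweedler3 D Z \<beta> d = sweedler2 D Z (\<lambda>d\<^sub>1 d'. sweedler2 D Z (\<lambda>d\<^sub>2 d\<^sub>3. \<beta> d\<^sub>1 d\<^sub>2 d\<^sub>3) d') d"

text \<open>Coassociativity is stated in \<open>(D \<otimes> D) \<otimes> D\<close>.\<close>

definition coalgebra :: "('k::field, 'a, 'm) bialg_scheme \<Rightarrow> bool" where
  "coalgebra D \<longleftrightarrow> vspace D \<and>
     linear_map D (tensor_space D D) (comult D) \<and> linear_map D ground (counit D) \<and>
     (let D2 = tensor_space D D; D3 = tensor_space D2 D;
          t3 = (\<lambda>x y z. tensor D2 D (tensor D D x y) z)
      in \<forall>d\<in>carrier D.
        sweedler2 D D3 (\<lambda>d' d\<^sub>3. sweedler2 D D3 (\<lambda>d\<^sub>1 d\<^sub>2. t3 d\<^sub>1 d\<^sub>2 d\<^sub>3) d') d =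
        sweedler2 D D3 (\<lambda>d\<^sub>1 d'. sweedler2 D D3 (\<lambda>d\<^sub>2 d\<^sub>3. t3 d\<^sub>1 d\<^sub>2 d\<^sub>3) d') d) \<and>
     (\<forall>d\<in>carrier D.
        sweedler2 D D (\<lambda>d\<^sub>1 d\<^sub>2. counit D d\<^sub>1 \<odot>\<^bsub>D\<^esub> d\<^sub>2) d = d \<and>
        sweedler2 D D (\<lambda>d\<^sub>1 d\<^sub>2. counit D d\<^sub>2 \<odot>\<^bsub>D\<^esub> d\<^sub>1) d = d)"

definition bialgebra :: "('k::field, 'a, 'm) bialg_scheme \<Rightarrow> bool" where
  "bialgebra D \<longleftrightarrow> unital_algebra D \<and> coalgebra D \<and>
     algebra_hom D (tensor_algebra D D) (comult D) \<and> algebra_hom D ground (counit D)"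

text \<open>
  The tensor product bialgebra: \<open>\<Delta>(a \<otimes> b) = (a\<^sub>(\<^sub>1\<^sub>) \<otimes> b\<^sub>(\<^sub>1\<^sub>)) \<otimes> (a\<^sub>(\<^sub>2\<^sub>) \<otimes> b\<^sub>(\<^sub>2\<^sub>))\<close> and
  \<open>\<epsilon>(a \<otimes> b) = \<epsilon>(a) \<epsilon>(b)\<close>.
\<close>

definition tensor_bialgebra ::
    "('k::field, 'a, 'm) bialg_scheme \<Rightarrow> ('k, 'b, 'n) bialg_scheme
      \<Rightarrow> ('k, ('k, 'a, 'b) tens) bialg" where
  "tensor_bialgebra A B = module.extend (tensor_algebra A B)
     (let T = tensor_space A B; TT = tensor_space T T in
      bialg.fields
        (lift TT (\<lambda>a b. sweedler2 A TT (\<lambda>a\<^sub>1 a\<^sub>2. sweedler2 B TT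
           (\<lambda>b\<^sub>1 b\<^sub>2. tensor T T (tensor A B a\<^sub>1 b\<^sub>1) (tensor A B a\<^sub>2 b\<^sub>2)) b) a))
        (lift ground (\<lambda>a b. counit A a * counit B b)))"


section \<open>Convolution and twists\<close>

definition convolution :: "('k::field, 'a, 'm) bialg_scheme \<Rightarrow> ('a \<Rightarrow> 'k) \<Rightarrow> ('a \<Rightarrow> 'k) \<Rightarrow> 'a \<Rightarrow> 'k" where
  "convolution D f g = sweedler2 D ground (\<lambda>d\<^sub>1 d\<^sub>2. f d\<^sub>1 * g d\<^sub>2)"

definition is_conv_inverse :: "('k::field, 'a, 'm) bialg_scheme \<Rightarrow> ('a \<Rightarrow> 'k) \<Rightarrow> ('a \<Rightarrow> 'k) \<Rightarrow> bool" where
  "is_conv_inverse D f g \<longleftrightarrow> linear_map D ground g \<and>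
     (\<forall>d\<in>carrier D. convolution D f g d = counit D d \<and> convolution D g f d = counit D d)"

text \<open>
  A convolution inverse is unique on the carrier of \<open>D\<close>; its values elsewhere are never used.
\<close>

definition conv_inverse :: "('k::field, 'a, 'm) bialg_scheme \<Rightarrow> ('a \<Rightarrow> 'k) \<Rightarrow> 'a \<Rightarrow> 'k" where
  "conv_inverse D f = (SOME g. is_conv_inverse D f g)"

definition dual_Drinfeld_twist ::
    "('k::field, 'a, 'm) bialg_scheme \<Rightarrow> (('k, 'a, 'a) tens \<Rightarrow> 'k) \<Rightarrow> bool" where
  "dual_Drinfeld_twist D J \<longleftrightarrow>
     (let D2 = tensor_bialgebra D D; D3 = tensor_bialgebra D2 D; j = (\<lambda>x y. J (tensor D D x y)) in
      linear_map D2 ground J \<and> (\<exists>g. is_conv_inverse D2 J g) \<and>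
      (\<forall>a\<in>carrier D.
         sweedler2 D D (\<lambda>a\<^sub>1 a\<^sub>2. j a\<^sub>1 \<one>\<^bsub>D\<^esub> \<odot>\<^bsub>D\<^esub> a\<^sub>2) a = sweedler2 D D (\<lambda>a\<^sub>1 a\<^sub>2. j a\<^sub>2 \<one>\<^bsub>D\<^esub> \<odot>\<^bsub>D\<^esub> a\<^sub>1) a \<and>
         sweedler2 D D (\<lambda>a\<^sub>1 a\<^sub>2. j \<one>\<^bsub>D\<^esub> a\<^sub>1 \<odot>\<^bsub>D\<^esub> a\<^sub>2) a = sweedler2 D D (\<lambda>a\<^sub>1 a\<^sub>2. j \<one>\<^bsub>D\<^esub> a\<^sub>2 \<odot>\<^bsub>D\<^esub> a\<^sub>1) a) \<and>
      (\<forall>w\<in>carrier D3.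
         convolution D3 (lift3 ground (\<lambda>x y z. j (x \<otimes>\<^bsub>D\<^esub> y) z))
                        (lift3 ground (\<lambda>x y z. j x y * counit D z)) w =
         convolution D3 (lift3 ground (\<lambda>x y z. j x (y \<otimes>\<^bsub>D\<^esub> z)))
                        (lift3 ground (\<lambda>x y z. counit D x * j y z)) w))"

definition twisted_mult ::
    "('k::field, 'a, 'm) bialg_scheme \<Rightarrow> (('k, 'a, 'a) tens \<Rightarrow> 'k) \<Rightarrow> 'a \<Rightarrow> 'a \<Rightarrow> 'a" where
  "twisted_mult D J x y =
     sweedler3 D D (\<lambda>x\<^sub>1 x\<^sub>2 x\<^sub>3. sweedler3 D D (\<lambda>y\<^sub>1 y\<^sub>2 y\<^sub>3.
       (conv_inverse (tensor_bialgebra D D) J (tensor D D x\<^sub>1 y\<^sub>1) * J (tensor D D x\<^sub>3 y\<^sub>3))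
         \<odot>\<^bsub>D\<^esub> (x\<^sub>2 \<otimes>\<^bsub>D\<^esub> y\<^sub>2)) y) x"

definition twisted_algebra ::
    "('k::field, 'a, 'm) bialg_scheme \<Rightarrow> (('k, 'a, 'a) tens \<Rightarrow> 'k) \<Rightarrow> ('k, 'a, 'm) bialg_scheme" where
  "twisted_algebra D J = D\<lparr>mult := twisted_mult D J\<rparr>"

definition leg23 ::
    "('k::field, 'a, 'm) bialg_scheme \<Rightarrow> ('k, 'b, 'n) bialg_scheme \<Rightarrow> (('k, 'b, 'a) tens \<Rightarrow> 'k)
      \<Rightarrow> ('k, ('k, 'a, 'b) tens, ('k, 'a, 'b) tens) tens \<Rightarrow> 'k" where
  "leg23 A B F = lift ground (\<lambda>s t. lift ground (\<lambda>a b. lift ground (\<lambda>a' b'.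
     counit A a * F (tensor B A b a') * counit B b') t) s)"

definition relative_dual_Drinfeld_twist ::
    "('k::field, 'a, 'm) bialg_scheme \<Rightarrow> ('k, 'b, 'n) bialg_scheme \<Rightarrow> (('k, 'b, 'a) tens \<Rightarrow> 'k) \<Rightarrow> bool" where
  "relative_dual_Drinfeld_twist A B F \<longleftrightarrow>
     linear_map (tensor_space B A) ground F \<and>
     dual_Drinfeld_twist (tensor_bialgebra A B) (leg23 A B F)"

end

theory Submission
  imports Defs
begin

text \<open>
  Write \<open>D = A \<otimes> B\<close> with \<open>J = \<F>\<^sub>2\<^sub>,\<^sub>3\<close>, and let the convolution algebra of functionals on \<open>D \<otimes> D\<close> act
  from both sides on linear maps \<open>D \<otimes> D \<rightarrow> U\<close>. For \<open>\<phi> = m\<^sub>U \<circ> (\<phi>\<^sub>A \<otimes> \<phi>\<^sub>B)\<close>, twisting the multiplication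
  \<open>m\<^sub>D\<close> means \<open>\<phi> \<circ> \<bullet> = J\<^sup>-\<^sup>1 * (\<phi> \<circ> m\<^sub>D) * J\<close>, so \<open>\<phi>\<close> is multiplicative for the twisted product iff
  \<open>J * (m\<^sub>U \<circ> (\<phi> \<otimes> \<phi>)) = (\<phi> \<circ> m\<^sub>D) * J\<close>; in this form no formula for \<open>J\<^sup>-\<^sup>1\<close> is needed.
  On \<open>(a \<otimes> b) \<otimes> (c \<otimes> d)\<close> the counits in \<open>J\<close> collapse, and the two sides are
  \<open>\<phi>\<^sub>A(a) L(c,b) \<phi>\<^sub>B(d)\<close> and \<open>\<phi>\<^sub>A(a) R(c,b) \<phi>\<^sub>B(d)\<close>, where \<open>L\<close> and \<open>R\<close> are the two sides of the
  commutation relation. Taking \<open>a = 1\<close> and \<open>d = 1\<close> recovers the relation itself.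
\<close>

section \<open>Vector spaces and evaluation of formal sums\<close>

text \<open>Elements of V \<otimes> W are cosets of formal sums and \<open>lift\<close> is a
  \<open>the_elem\<close>, so a Sweedler expression has its intended meaning only once its integrand
  is known to be multilinear on the carriers. Every rewriting step therefore carries multilinearity
  obligations, and much of the preparation serves to make them dischargeable by resolution. Sums are
  never written out. Three principles replace them: linear maps that agree on elementary tensors are
  equal, a lift depends linearly on parameters of its integrand, and two independent lifts may be
  exchanged. Moving J across the equation is associativity of the convolution action followed by J *
  J^-1 = \<epsilon>. This takes place over the coalgebra D \<otimes> D, which is itself a tensor
  product of tensor products, so coassociativity and counitality have to be inherited by
  \<open>tensor_bialgebra\<close> in general and are then applied twice: once to reach D from A and
  B, once to reach D \<otimes> D.\<close>

lemma ground_simps [simp]: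
  "carrier ground = UNIV" "x \<otimes>\<^bsub>ground\<^esub> y = x * y" "\<one>\<^bsub>ground\<^esub> = 1" "\<zero>\<^bsub>ground\<^esub> = 0"
  "x \<oplus>\<^bsub>ground\<^esub> y = x + y" "c \<odot>\<^bsub>ground\<^esub> x = c * x"
  by (simp_all add: ground_def)

lemma vspace_ground [simp]: "vspace ground"
proof -
  have "abelian_group (ground :: ('k::field, 'k) module)"
    by (rule abelian_groupI) (auto simp: algebra_simps intro: exI[of _ "- x" for x])
  moreover have "comm_monoid (ground :: ('k::field, 'k) module)"
    by (rule comm_monoidI) (auto simp: algebra_simps)
  ultimately have "cring (ground :: ('k::field, 'k) module)"
    by (intro cringI) (auto simp: algebra_simps)
  with \<open>abelian_group (ground :: ('k::field, 'k) module)\<close> show ?thesis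
    by (intro moduleI) (auto simp: algebra_simps)
qed

lemma vspaceI:
  fixes V :: "('k::field, 'a, 'm) module_scheme"
  assumes "abelian_group V"
    and "\<And>c x. x \<in> carrier V \<Longrightarrow> c \<odot>\<^bsub>V\<^esub> x \<in> carrier V"
    and "\<And>c d x. x \<in> carrier V \<Longrightarrow> (c + d) \<odot>\<^bsub>V\<^esub> x = c \<odot>\<^bsub>V\<^esub> x \<oplus>\<^bsub>V\<^esub> d \<odot>\<^bsub>V\<^esub> x"
    and "\<And>c x y. x \<in> carrier V \<Longrightarrow> y \<in> carrier V \<Longrightarrow> c \<odot>\<^bsub>V\<^esub> (x \<oplus>\<^bsub>V\<^esub> y) = c \<odot>\<^bsub>V\<^esub> x \<oplus>\<^bsub>V\<^esub> c \<odot>\<^bsub>V\<^esub> y"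
    and "\<And>c d x. x \<in> carrier V \<Longrightarrow> (c * d) \<odot>\<^bsub>V\<^esub> x = c \<odot>\<^bsub>V\<^esub> (d \<odot>\<^bsub>V\<^esub> x)"
    and "\<And>x. x \<in> carrier V \<Longrightarrow> 1 \<odot>\<^bsub>V\<^esub> x = x"
  shows "vspace V"
proof (rule moduleI)
  show "cring (ground :: ('k, 'k) module)"
    using vspace_ground by (rule module.axioms)
qed (use assms in auto)

context
  fixes V :: "('k::field, 'a, 'm) module_scheme"
  assumes V: "vspace V"
begin

interpretation V: Module.module ground V by (fact V)

lemma vspace_zero_closed [simp]: "\<zero>\<^bsub>V\<^esub> \<in> carrier V"
  by simp

lemma vspace_add_closed [simp]: "x \<in> carrier V \<Longrightarrow> y \<in> carrier V \<Longrightarrow> x \<oplus>\<^bsub>V\<^esub> y \<in> carrier V"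
  by simp

lemma vspace_smult_closed [simp]: "x \<in> carrier V \<Longrightarrow> c \<odot>\<^bsub>V\<^esub> x \<in> carrier V"
  by simp

lemma vspace_smult_add_left: "x \<in> carrier V \<Longrightarrow> (c + d) \<odot>\<^bsub>V\<^esub> x = c \<odot>\<^bsub>V\<^esub> x \<oplus>\<^bsub>V\<^esub> d \<odot>\<^bsub>V\<^esub> x"
  using V.smult_l_distr[of c d x] by simp

lemma vspace_smult_add_right:
  "x \<in> carrier V \<Longrightarrow> y \<in> carrier V \<Longrightarrow> c \<odot>\<^bsub>V\<^esub> (x \<oplus>\<^bsub>V\<^esub> y) = c \<odot>\<^bsub>V\<^esub> x \<oplus>\<^bsub>V\<^esub> c \<odot>\<^bsub>V\<^esub> y"
  using V.smult_r_distr[of c x y] by simp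

lemma vspace_smult_smult: "x \<in> carrier V \<Longrightarrow> c \<odot>\<^bsub>V\<^esub> (d \<odot>\<^bsub>V\<^esub> x) = (c * d) \<odot>\<^bsub>V\<^esub> x"
  using V.smult_assoc1[of c d x] by simp

lemma vspace_smult_one [simp]: "x \<in> carrier V \<Longrightarrow> 1 \<odot>\<^bsub>V\<^esub> x = x"
  using V.smult_one[of x] by simp

lemma vspace_smult_zero_left [simp]: "x \<in> carrier V \<Longrightarrow> 0 \<odot>\<^bsub>V\<^esub> x = \<zero>\<^bsub>V\<^esub>"
  using V.smult_l_null[of x] by simp

lemma vspace_smult_zero_right [simp]: "c \<odot>\<^bsub>V\<^esub> \<zero>\<^bsub>V\<^esub> = \<zero>\<^bsub>V\<^esub>"
  using V.smult_r_null[of c] by simp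

end

lemma linear_mapI:
  assumes "\<And>x. x \<in> carrier V \<Longrightarrow> f x \<in> carrier W"
    and "\<And>x y. x \<in> carrier V \<Longrightarrow> y \<in> carrier V \<Longrightarrow> f (x \<oplus>\<^bsub>V\<^esub> y) = f x \<oplus>\<^bsub>W\<^esub> f y"
    and "\<And>c x. x \<in> carrier V \<Longrightarrow> f (c \<odot>\<^bsub>V\<^esub> x) = c \<odot>\<^bsub>W\<^esub> f x"
  shows "linear_map V W f"
  using assms by (simp add: linear_map_def)

lemma
  assumes "linear_map V W f"
  shows linear_map_closed: "x \<in> carrier V \<Longrightarrow> f x \<in> carrier W"
    and linear_map_add: "x \<in> carrier V \<Longrightarrow> y \<in> carrier V \<Longrightarrow> f (x \<oplus>\<^bsub>V\<^esub> y) = f x \<oplus>\<^bsub>W\<^esub> f y"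
    and linear_map_smult: "x \<in> carrier V \<Longrightarrow> f (c \<odot>\<^bsub>V\<^esub> x) = c \<odot>\<^bsub>W\<^esub> f x"
  using assms by (auto simp: linear_map_def)

lemma linear_map_zero:
  assumes "linear_map V W f" "vspace V" "vspace W"
  shows "f \<zero>\<^bsub>V\<^esub> = \<zero>\<^bsub>W\<^esub>"
proof -
  have "f (0 \<odot>\<^bsub>V\<^esub> \<zero>\<^bsub>V\<^esub>) = 0 \<odot>\<^bsub>W\<^esub> f \<zero>\<^bsub>V\<^esub>"
    using assms by (intro linear_map_smult) auto
  then show ?thesis
    using assms linear_map_closed[OF assms(1)] by simp
qed

text \<open>Functions are total, so their values off the carrier are arbitrary; closure of the
  carrier under the operations makes agreement on it sufficient.\<close>

lemma linear_map_cong: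
  assumes "vspace V" "linear_map V W f" "\<And>x. x \<in> carrier V \<Longrightarrow> g x = f x"
  shows "linear_map V W g"
  using assms by (simp add: linear_map_def Pi_iff)

definition bilinear_map ::
    "('k::field, 'a, 'm) module_scheme \<Rightarrow> ('k, 'b, 'n) module_scheme
      \<Rightarrow> ('k, 'c, 'o) module_scheme \<Rightarrow> ('a \<Rightarrow> 'b \<Rightarrow> 'c) \<Rightarrow> bool" where
  "bilinear_map V W Z \<beta> \<longleftrightarrow>
     (\<forall>x\<in>carrier V. linear_map W Z (\<lambda>y. \<beta> x y)) \<and> (\<forall>y\<in>carrier W. linear_map V Z (\<lambda>x. \<beta> x y))"

lemma bilinear_mapI:
  assumes "\<And>x. x \<in> carrier V \<Longrightarrow> linear_map W Z (\<lambda>y. \<beta> x y)"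
    and "\<And>y. y \<in> carrier W \<Longrightarrow> linear_map V Z (\<lambda>x. \<beta> x y)"
  shows "bilinear_map V W Z \<beta>"
  using assms by (simp add: bilinear_map_def)

lemma
  assumes "bilinear_map V W Z \<beta>"
  shows bilinear_map_left: "y \<in> carrier W \<Longrightarrow> linear_map V Z (\<lambda>x. \<beta> x y)"
    and bilinear_map_right: "x \<in> carrier V \<Longrightarrow> linear_map W Z (\<lambda>y. \<beta> x y)"
    and bilinear_map_closed: "x \<in> carrier V \<Longrightarrow> y \<in> carrier W \<Longrightarrow> \<beta> x y \<in> carrier Z"
  using assms by (auto simp: bilinear_map_def intro: linear_map_closed)

section \<open>Formal sums and their evaluation\<close>

lemma lookup_fscale [simp]: "Poly_Mapping.lookup (fscale c f) p = c * Poly_Mapping.lookup f p"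
  by (simp add: fscale_def Poly_Mapping.map.rep_eq when_def)

lemma fscale_simps:
  "fscale c (f + g) = fscale c f + fscale c g"
  "fscale (c + d) f = fscale c f + fscale d f"
  "fscale c (fscale d f) = fscale (c * d) f"
  "fscale c (f - g) = fscale c f - fscale c g"
  "fscale 1 f = f" "fscale 0 f = 0" "fscale (-1) f = - f"
  by (auto intro!: poly_mapping_eqI simp: algebra_simps lookup_add lookup_minus)

lemma keys_fscale: "Poly_Mapping.keys (fscale c f) \<subseteq> Poly_Mapping.keys f"
  by (auto simp: in_keys_iff)

text \<open>The map inside \<open>lift\<close> before the passage to the quotient. It is linear in
  the formal sum as soon as \<open>\<beta>\<close> takes carrier values; bilinearity enters when
  \<open>tensor_null\<close> has to be sent to zero.\<close>

definition tensor_eval ::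
    "('k::field, 'z, 'n) module_scheme \<Rightarrow> ('a \<Rightarrow> 'b \<Rightarrow> 'z) \<Rightarrow> ('a \<times> 'b \<Rightarrow>\<^sub>0 'k) \<Rightarrow> 'z" where
  "tensor_eval Z \<beta> f =
     (\<Oplus>\<^bsub>Z\<^esub>p\<in>Poly_Mapping.keys f. Poly_Mapping.lookup f p \<odot>\<^bsub>Z\<^esub> \<beta> (fst p) (snd p))"

context
  fixes Z :: "('k::field, 'z, 'n) module_scheme" and \<beta> :: "'a \<Rightarrow> 'b \<Rightarrow> 'z"
    and V :: "('k, 'a, 'm) module_scheme" and W :: "('k, 'b, 'n') module_scheme"
  assumes Z: "vspace Z"
    and \<beta>: "\<And>x y. x \<in> carrier V \<Longrightarrow> y \<in> carrier W \<Longrightarrow> \<beta> x y \<in> carrier Z"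
begin

interpretation Z: Module.module ground Z by (fact Z)

text \<open>Cancellation can shrink the support of a sum or a multiple. Terms outside the support
  contribute zero, so formal sums with different supports can be compared over one common finite
  index set.\<close>

lemma tensor_eval_superset:
  assumes "finite K" "Poly_Mapping.keys f \<subseteq> K" "K \<subseteq> carrier V \<times> carrier W"
  shows "tensor_eval Z \<beta> f = (\<Oplus>\<^bsub>Z\<^esub>p\<in>K. Poly_Mapping.lookup f p \<odot>\<^bsub>Z\<^esub> \<beta> (fst p) (snd p))"
  unfolding tensor_eval_def
proof (rule Z.add.finprod_mono_neutral_cong_left)
  show "(\<lambda>p. Poly_Mapping.lookup f p \<odot>\<^bsub>Z\<^esub> \<beta> (fst p) (snd p)) \<in> K \<rightarrow> carrier Z"
    using assms \<beta> by (auto intro!: vspace_smult_closed[OF Z])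
  show "Poly_Mapping.lookup f i \<odot>\<^bsub>Z\<^esub> \<beta> (fst i) (snd i) = \<zero>\<^bsub>Z\<^esub>"
    if "i \<in> K - Poly_Mapping.keys f" for i
  proof -
    have "\<beta> (fst i) (snd i) \<in> carrier Z"
      using that assms by (intro \<beta>) auto
    then show ?thesis
      using that Z by (auto simp: in_keys_iff)
  qed
qed (use assms in auto)

lemma tensor_eval_closed: "Poly_Mapping.keys f \<subseteq> carrier V \<times> carrier W \<Longrightarrow> tensor_eval Z \<beta> f \<in> carrier Z"
  unfolding tensor_eval_def using \<beta> by (intro Z.finsum_closed) (auto intro!: vspace_smult_closed[OF Z])

lemma tensor_eval_add:
  assumes "Poly_Mapping.keys f \<subseteq> carrier V \<times> carrier W" "Poly_Mapping.keys g \<subseteq> carrier V \<times> carrier W"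
  shows "tensor_eval Z \<beta> (f + g) = tensor_eval Z \<beta> f \<oplus>\<^bsub>Z\<^esub> tensor_eval Z \<beta> g"
proof -
  let ?K = "Poly_Mapping.keys f \<union> Poly_Mapping.keys g"
  have *: "\<beta> (fst p) (snd p) \<in> carrier Z" if "p \<in> ?K" for p
    using that assms by (intro \<beta>) auto
  have K: "finite ?K" "?K \<subseteq> carrier V \<times> carrier W"
    using assms by auto
  have "tensor_eval Z \<beta> (f + g) =
      (\<Oplus>\<^bsub>Z\<^esub>p\<in>?K. Poly_Mapping.lookup (f + g) p \<odot>\<^bsub>Z\<^esub> \<beta> (fst p) (snd p))"
    using K by (intro tensor_eval_superset keys_add)
  also have "\<dots> = (\<Oplus>\<^bsub>Z\<^esub>p\<in>?K. Poly_Mapping.lookup f p \<odot>\<^bsub>Z\<^esub> \<beta> (fst p) (snd p) \<oplus>\<^bsub>Z\<^esub>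
         Poly_Mapping.lookup g p \<odot>\<^bsub>Z\<^esub> \<beta> (fst p) (snd p))"
    by (rule Z.finsum_cong') (auto simp: lookup_add vspace_smult_add_left[OF Z] * Z)
  also have "\<dots> = (\<Oplus>\<^bsub>Z\<^esub>p\<in>?K. Poly_Mapping.lookup f p \<odot>\<^bsub>Z\<^esub> \<beta> (fst p) (snd p)) \<oplus>\<^bsub>Z\<^esub>
         (\<Oplus>\<^bsub>Z\<^esub>p\<in>?K. Poly_Mapping.lookup g p \<odot>\<^bsub>Z\<^esub> \<beta> (fst p) (snd p))"
    by (rule Z.finsum_addf) (auto simp: * Z)
  also have "\<dots> = tensor_eval Z \<beta> f \<oplus>\<^bsub>Z\<^esub> tensor_eval Z \<beta> g"
    using K by (simp add: tensor_eval_superset[of ?K])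
  finally show ?thesis .
qed

lemma tensor_eval_fscale:
  assumes "Poly_Mapping.keys f \<subseteq> carrier V \<times> carrier W"
  shows "tensor_eval Z \<beta> (fscale c f) = c \<odot>\<^bsub>Z\<^esub> tensor_eval Z \<beta> f"
proof -
  have *: "\<beta> (fst p) (snd p) \<in> carrier Z" if "p \<in> Poly_Mapping.keys f" for p
    using that assms by (intro \<beta>) auto
  show ?thesis
    using assms keys_fscale[of c f] *
    by (subst tensor_eval_superset[of "Poly_Mapping.keys f"])
      (auto intro!: Z.finsum_cong' simp: tensor_eval_def Z.finsum_smult_ldistr vspace_smult_smult[OF Z] Z)
qed

lemma tensor_eval_diff:
  assumes "Poly_Mapping.keys f \<subseteq> carrier V \<times> carrier W" "Poly_Mapping.keys g \<subseteq> carrier V \<times> carrier W"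
  shows "tensor_eval Z \<beta> (f - g) = tensor_eval Z \<beta> f \<ominus>\<^bsub>Z\<^esub> tensor_eval Z \<beta> g"
proof -
  have "tensor_eval Z \<beta> f = tensor_eval Z \<beta> (f - g) \<oplus>\<^bsub>Z\<^esub> tensor_eval Z \<beta> g"
    using tensor_eval_add[of "f - g" g] keys_diff[of f g] assms by auto
  moreover have "tensor_eval Z \<beta> (f - g) \<in> carrier Z"
    using assms keys_diff[of f g] by (intro tensor_eval_closed) auto
  ultimately show ?thesis
    using assms by (simp add: tensor_eval_closed Z.minus_eq Z.a_assoc Z.r_neg)
qed

lemma tensor_eval_gen:
  assumes "x \<in> carrier V" "y \<in> carrier W"
  shows "tensor_eval Z \<beta> (gen x y) = \<beta> x y"
  using \<beta>[OF assms] Z by (simp add: tensor_eval_def Z.finsum_insert)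

end

text \<open>The generators mention carrier elements only, and the carriers are closed under the
  operations. Hence adding a null sum to a representative supported in the carriers never leaves
  them, which the evaluation rules require.\<close>

lemma tensor_null_keys:
  assumes "f \<in> tensor_null V W" "vspace V" "vspace W"
  shows "Poly_Mapping.keys f \<subseteq> carrier V \<times> carrier W"
  using assms(1)
proof induction
  case (add f g)
  then show ?case using keys_add[of f g] by auto
next
  case (scale f c)
  then show ?case using keys_fscale[of c f] by auto
qed (use assms(2,3) in \<open>auto dest!: subsetD[OF keys_diff] subsetD[OF keys_fscale] split: if_splits\<close>)

text \<open>This makes \<open>lift\<close> well defined: each relation among the generators encodes
  one bilinearity law, so its value is a difference of equal elements, and linearity of the
  evaluation carries zero through the remaining closure rules.\<close>

lemma tensor_null_eval:
  fixes V :: "('k::field, 'a, 'm) module_scheme"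
  assumes f: "f \<in> tensor_null V W" and V: "vspace V" and W: "vspace W" and Z: "vspace Z"
    and \<beta>: "bilinear_map V W Z \<beta>"
  shows "tensor_eval Z \<beta> f = \<zero>\<^bsub>Z\<^esub>"
proof -
  interpret Z: Module.module ground Z by (fact Z)
  note closed = bilinear_map_closed[OF \<beta>]
  have [simp]: "x \<in> carrier V \<Longrightarrow> y \<in> carrier W \<Longrightarrow>
      Poly_Mapping.keys (fscale c (gen x y)) \<subseteq> carrier V \<times> carrier W" for x y and c :: 'k
    using keys_fscale[of c "gen x y"] by auto
  have [simp]: "x \<in> carrier V \<Longrightarrow> y \<in> carrier W \<Longrightarrow> x' \<in> carrier V \<Longrightarrow> y' \<in> carrier W \<Longrightarrow>
      Poly_Mapping.keys (gen x y - gen x' y' :: _ \<Rightarrow>\<^sub>0 'k) \<subseteq> carrier V \<times> carrier W" for x y x' y'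
    using keys_diff[of "gen x y :: _ \<Rightarrow>\<^sub>0 'k" "gen x' y'"] by auto
  note ev = tensor_eval_add[OF Z closed] tensor_eval_diff[OF Z closed]
    tensor_eval_fscale[OF Z closed] tensor_eval_gen[OF Z closed]
  show ?thesis
    using f
  proof induction
    case zero
    then show ?case by (simp add: tensor_eval_def)
  next
    case (add f g)
    then show ?case
      using Z by (simp add: ev tensor_null_keys[OF _ V W])
  next
    case (scale f c)
    then show ?case
      using Z by (simp add: ev tensor_null_keys[OF _ V W])
  next
    case (add_left x x' y)
    then show ?case
      using V W by (simp add: ev closed linear_map_add[OF bilinear_map_left[OF \<beta>]])
        (simp add: closed Z.minus_eq Z.a_ac Z.r_neg Z.minus_add Z.r_neg1 Z.r_neg2)
  next
    case (add_right x y y')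
    then show ?case
      using V W by (simp add: ev closed linear_map_add[OF bilinear_map_right[OF \<beta>]])
        (simp add: closed Z.minus_eq Z.a_ac Z.r_neg Z.minus_add Z.r_neg1 Z.r_neg2)
  next
    case (smult_left x y c)
    then show ?case
      using V W Z by (simp add: ev closed linear_map_smult[OF bilinear_map_left[OF \<beta>]] Z.r_neg Z.minus_eq)
  next
    case (smult_right x y c)
    then show ?case
      using V W Z by (simp add: ev closed linear_map_smult[OF bilinear_map_right[OF \<beta>]] Z.r_neg Z.minus_eq)
  qed
qed


section \<open>Linear maps on tensor products\<close>

lemma tensor_null_uminus: "f \<in> tensor_null V W \<Longrightarrow> - f \<in> tensor_null V W"
  using tensor_null.scale[of f V W "-1"] by (simp add: fscale_simps)

lemma tensor_null_diff: "f \<in> tensor_null V W \<Longrightarrow> g \<in> tensor_null V W \<Longrightarrow> f - g \<in> tensor_null V W"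
  using tensor_null.add[of f V W "- g"] tensor_null_uminus[of g V W] by simp

lemma tensor_class_eq_iff: "tensor_class V W f = tensor_class V W g \<longleftrightarrow> f - g \<in> tensor_null V W"
proof
  assume "tensor_class V W f = tensor_class V W g"
  moreover have "f \<in> tensor_class V W f"
    by (simp add: tensor_class_def tensor_null.zero)
  ultimately show "f - g \<in> tensor_null V W"
    by (simp add: tensor_class_def)
next
  assume *: "f - g \<in> tensor_null V W"
  have "h - f \<in> tensor_null V W \<longleftrightarrow> h - g \<in> tensor_null V W" for h
    using tensor_null.add[OF _ *, of "h - f"] tensor_null_diff[OF _ *, of "h - g"]
    by (auto simp: algebra_simps)
  then show "tensor_class V W f = tensor_class V W g"
    by (simp add: tensor_class_def)
qed

lemma tensor_space_add:
  "tensor_class V W f \<oplus>\<^bsub>tensor_space V W\<^esub> tensor_class V W g = tensor_class V W (f + g)"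
proof -
  have "h \<in> {f' + g' | f' g'. f' \<in> tensor_class V W f \<and> g' \<in> tensor_class V W g}"
    if "h - (f + g) \<in> tensor_null V W" for h
  proof -
    \<comment> \<open>An element of the coset of f + g is split by taking f itself from the first
      coset and leaving the whole null remainder to the second.\<close>
    have "f \<in> tensor_class V W f" "h - f \<in> tensor_class V W g" "h = f + (h - f)"
      using that by (simp_all add: tensor_class_def tensor_null.zero algebra_simps)
    then show ?thesis by blast
  qed
  moreover have "f' + g' - (f + g) \<in> tensor_null V W"
    if "f' - f \<in> tensor_null V W" "g' - g \<in> tensor_null V W" for f' g'
    using tensor_null.add[OF that] by (simp add: algebra_simps)
  ultimately show ?thesis
    by (auto simp: tensor_space_def tensor_class_def)
qed

text \<open>The summand \<open>n\<close> in \<open>smult\<close> matters for c = 0: scaling a coset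
  by 0 gives the single element 0, and adding the null subspace restores a full coset.\<close>

lemma tensor_space_smult:
  "c \<odot>\<^bsub>tensor_space V W\<^esub> tensor_class V W f = tensor_class V W (fscale c f)"
proof -
  have "h \<in> {fscale c f' + n | f' n. f' \<in> tensor_class V W f \<and> n \<in> tensor_null V W}"
    if "h - fscale c f \<in> tensor_null V W" for h
  proof -
    have "f \<in> tensor_class V W f" "h = fscale c f + (h - fscale c f)"
      by (simp_all add: tensor_class_def tensor_null.zero)
    then show ?thesis using that by blast
  qed
  moreover have "fscale c f' + n - fscale c f \<in> tensor_null V W"
    if "f' - f \<in> tensor_null V W" "n \<in> tensor_null V W" for f' n
    using tensor_null.add[OF tensor_null.scale[OF that(1), of c] that(2)]
    by (simp add: fscale_simps algebra_simps)
  ultimately show ?thesis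
    by (auto simp: tensor_space_def tensor_class_def)
qed

lemma tensor_space_zero: "\<zero>\<^bsub>tensor_space V W\<^esub> = tensor_class V W 0"
  by (simp add: tensor_space_def tensor_class_def)

lemma tensor_class_closed:
  "Poly_Mapping.keys f \<subseteq> carrier V \<times> carrier W \<Longrightarrow> tensor_class V W f \<in> carrier (tensor_space V W)"
  by (auto simp: tensor_space_def)

lemma tensor_space_cases:
  assumes "X \<in> carrier (tensor_space V W)"
  obtains f where "Poly_Mapping.keys f \<subseteq> carrier V \<times> carrier W" "X = tensor_class V W f"
  using assms by (auto simp: tensor_space_def)

lemma keys_add_subset:
  "Poly_Mapping.keys f \<subseteq> S \<Longrightarrow> Poly_Mapping.keys g \<subseteq> S \<Longrightarrow> Poly_Mapping.keys (f + g) \<subseteq> S"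
  using keys_add[of f g] by auto

lemma keys_fscale_subset: "Poly_Mapping.keys f \<subseteq> S \<Longrightarrow> Poly_Mapping.keys (fscale c f) \<subseteq> S"
  using keys_fscale[of c f] by auto

lemmas tensor_space_ops = tensor_space_add tensor_space_smult tensor_space_zero

text \<open>The axioms descend from formal sums, where support in a fixed product set is stable
  under sums, negatives and multiples. Stated for arbitrary records, the fact can fire as a
  simplification rule without side conditions.\<close>

lemma vspace_tensor_space [simp]: "vspace (tensor_space V W)"
proof (rule vspaceI)
  show "abelian_group (tensor_space V W)"
  proof (rule abelian_groupI)
    fix X assume "X \<in> carrier (tensor_space V W)"
    then show "\<exists>Y\<in>carrier (tensor_space V W). Y \<oplus>\<^bsub>tensor_space V W\<^esub> X = \<zero>\<^bsub>tensor_space V W\<^esub>"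
      by (elim tensor_space_cases)
        (auto intro!: bexI[of _ "tensor_class V W (- f)" for f] tensor_class_closed simp: tensor_space_ops)
  qed (auto elim!: tensor_space_cases
      simp: tensor_class_closed keys_add_subset tensor_space_ops add_ac)
qed (auto elim!: tensor_space_cases
    simp: tensor_class_closed keys_fscale_subset tensor_space_ops fscale_simps)

lemma tensor_closed:
  "x \<in> carrier V \<Longrightarrow> y \<in> carrier W \<Longrightarrow> tensor V W x y \<in> carrier (tensor_space V W)"
  by (auto simp: tensor_def intro!: tensor_class_closed)

text \<open>Each relation generating \<open>tensor_null\<close> is one of these laws with all terms
  moved to one side.\<close>

lemma bilinear_map_tensor:
  assumes "vspace V" "vspace W"
  shows "bilinear_map V W (tensor_space V W) (tensor V W)"
proof (intro bilinear_mapI linear_mapI)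
  fix x y y' assume "x \<in> carrier V" "y \<in> carrier W" "y' \<in> carrier W"
  then show "tensor V W x (y \<oplus>\<^bsub>W\<^esub> y') = tensor V W x y \<oplus>\<^bsub>tensor_space V W\<^esub> tensor V W x y'"
    using tensor_null.add_right[of x V y W y']
    by (simp add: tensor_def tensor_space_ops tensor_class_eq_iff algebra_simps)
next
  fix x x' y assume "x \<in> carrier V" "x' \<in> carrier V" "y \<in> carrier W"
  then show "tensor V W (x \<oplus>\<^bsub>V\<^esub> x') y = tensor V W x y \<oplus>\<^bsub>tensor_space V W\<^esub> tensor V W x' y"
    using tensor_null.add_left[of x V x' y W]
    by (simp add: tensor_def tensor_space_ops tensor_class_eq_iff algebra_simps)
next
  fix c x y assume "x \<in> carrier V" "y \<in> carrier W"
  then show "tensor V W x (c \<odot>\<^bsub>W\<^esub> y) = c \<odot>\<^bsub>tensor_space V W\<^esub> tensor V W x y"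
    and "tensor V W (c \<odot>\<^bsub>V\<^esub> x) y = c \<odot>\<^bsub>tensor_space V W\<^esub> tensor V W x y"
    by (simp_all add: tensor_def tensor_space_ops tensor_class_eq_iff
        tensor_null.smult_left tensor_null.smult_right)
qed (simp_all add: tensor_closed)

text \<open>Every class is a finite linear combination of elementary tensors, so a representative
  can be built by inserting one key at a time. The bound on the support travels along and keeps all
  intermediate classes in the carrier.\<close>

lemma tensor_induct [consumes 1, case_names tensor zero add smult]:
  assumes X: "X \<in> carrier (tensor_space V W)"
    and tensor: "\<And>x y. x \<in> carrier V \<Longrightarrow> y \<in> carrier W \<Longrightarrow> P (tensor V W x y)"
    and zero: "P \<zero>\<^bsub>tensor_space V W\<^esub>"
    and add: "\<And>X Y. X \<in> carrier (tensor_space V W) \<Longrightarrow> Y \<in> carrier (tensor_space V W) \<Longrightarrow>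
      P X \<Longrightarrow> P Y \<Longrightarrow> P (X \<oplus>\<^bsub>tensor_space V W\<^esub> Y)"
    and smult: "\<And>c X. X \<in> carrier (tensor_space V W) \<Longrightarrow> P X \<Longrightarrow> P (c \<odot>\<^bsub>tensor_space V W\<^esub> X)"
  shows "P X"
proof -
  have "P (tensor_class V W f)" if "Poly_Mapping.keys f \<subseteq> carrier V \<times> carrier W" for f
    using that
  proof (induction f rule: update_induct)
    case const
    then show ?case using zero by (simp add: tensor_space_zero)
  next
    case (update f p c)
    obtain x y where p: "p = (x, y)" by (cases p)
    have keys: "Poly_Mapping.keys f \<subseteq> carrier V \<times> carrier W" "x \<in> carrier V" "y \<in> carrier W"
      using update.prems update.hyps by (auto simp: p keys_update)
    \<comment> \<open>The inserted key is new, so its old coefficient is 0 and overwriting amounts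
      to adding \<open>c\<close> times a generator.\<close>
    have "Poly_Mapping.update p c f = f + fscale c (gen x y)"
      using update.hyps by (intro poly_mapping_eqI)
        (auto simp: p lookup_add lookup_update lookup_single in_keys_iff)
    then have "tensor_class V W (Poly_Mapping.update p c f) =
        tensor_class V W f \<oplus>\<^bsub>tensor_space V W\<^esub> c \<odot>\<^bsub>tensor_space V W\<^esub> tensor V W x y"
      by (simp add: tensor_space_ops tensor_def)
    then show ?case
      using keys update.IH by (auto intro!: add smult tensor tensor_closed tensor_class_closed vspace_smult_closed)
  qed
  then show ?thesis
    using X by (auto elim: tensor_space_cases)
qed

section \<open>The universal property of the tensor product\<close>

context
  fixes V :: "('k::field, 'a, 'm) module_scheme" and W :: "('k, 'b, 'n) module_scheme"
    and Z :: "('k, 'z, 'o) module_scheme"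
  assumes V: "vspace V" and W: "vspace W" and Z: "vspace Z"
begin

text \<open>Two representatives differ by a null sum, whose value is zero. The set of values over
  the coset is therefore a singleton, and \<open>the_elem\<close> returns its element.\<close>

lemma lift_tensor_class:
  assumes \<beta>: "bilinear_map V W Z \<beta>" and f: "Poly_Mapping.keys f \<subseteq> carrier V \<times> carrier W"
  shows "lift Z \<beta> (tensor_class V W f) = tensor_eval Z \<beta> f"
proof -
  interpret Z: Module.module ground Z by (fact Z)
  note closed = bilinear_map_closed[OF \<beta>]
  have "tensor_eval Z \<beta> g = tensor_eval Z \<beta> f" if "g - f \<in> tensor_null V W" for g
  proof -
    have "tensor_eval Z \<beta> g = tensor_eval Z \<beta> (g - f) \<oplus>\<^bsub>Z\<^esub> tensor_eval Z \<beta> f"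
      using tensor_eval_add[OF Z closed tensor_null_keys[OF that V W] f] by simp
    then show ?thesis
      using f by (simp add: tensor_null_eval[OF that V W Z \<beta>] tensor_eval_closed[OF Z closed])
  qed
  moreover have "f \<in> tensor_class V W f"
    by (simp add: tensor_class_def tensor_null.zero)
  ultimately have "tensor_eval Z \<beta> ` tensor_class V W f = {tensor_eval Z \<beta> f}"
    unfolding tensor_class_def by blast
  then show ?thesis
    by (simp add: lift_def tensor_eval_def[abs_def])
qed

lemma lift_tensor:
  assumes "bilinear_map V W Z \<beta>" "x \<in> carrier V" "y \<in> carrier W"
  shows "lift Z \<beta> (tensor V W x y) = \<beta> x y"
  using assms tensor_eval_gen[OF Z bilinear_map_closed[OF assms(1)]]
  by (simp add: tensor_def lift_tensor_class)

lemma linear_map_lift: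
  assumes \<beta>: "bilinear_map V W Z \<beta>"
  shows "linear_map (tensor_space V W) Z (lift Z \<beta>)"
proof -
  note closed = bilinear_map_closed[OF \<beta>]
  show ?thesis
    by (rule linear_mapI) (auto elim!: tensor_space_cases simp: tensor_space_ops lift_tensor_class[OF \<beta>]
        keys_add_subset keys_fscale_subset tensor_eval_closed[OF Z closed] tensor_eval_add[OF Z closed]
        tensor_eval_fscale[OF Z closed])
qed

text \<open>The two sets of values are compared directly: every representative of \<open>X\<close>
  differs by a null sum from one supported in the carriers, so it is supported there as well, where
  the integrands agree.\<close>

lemma lift_cong:
  assumes "bilinear_map V W Z \<beta>" "X \<in> carrier (tensor_space V W)"
    and eq: "\<And>x y. x \<in> carrier V \<Longrightarrow> y \<in> carrier W \<Longrightarrow> \<beta>' x y = \<beta> x y"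
  shows "lift Z \<beta>' X = lift Z \<beta> X"
proof -
  interpret Z: Module.module ground Z by (fact Z)
  obtain f where f: "Poly_Mapping.keys f \<subseteq> carrier V \<times> carrier W" "X = tensor_class V W f"
    using assms(2) by (rule tensor_space_cases)
  have "tensor_eval Z \<beta>' g = tensor_eval Z \<beta> g" if "g \<in> X" for g
  proof -
    have "Poly_Mapping.keys g \<subseteq> carrier V \<times> carrier W"
      using that f keys_add_subset[OF tensor_null_keys[of "g - f" V W] f(1)] V W
      by (auto simp: tensor_class_def)
    then show ?thesis
      unfolding tensor_eval_def using bilinear_map_closed[OF assms(1)]
      by (intro Z.finsum_cong') (auto simp: eq Z subset_iff)
  qed
  then have "tensor_eval Z \<beta>' ` X = tensor_eval Z \<beta> ` X"
    by (rule image_cong[OF refl])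
  then show ?thesis
    by (simp add: lift_def tensor_eval_def[abs_def])
qed

end

text \<open>The uniqueness half of the universal property, and the standard way below to reduce an
  identity on a tensor product to one between Sweedler sums of the factors.\<close>

lemma linear_map_eq_on_tensors:
  assumes f: "linear_map (tensor_space V W) Z f" and g: "linear_map (tensor_space V W) Z g"
    and Z: "vspace Z" and X: "X \<in> carrier (tensor_space V W)"
    and eq: "\<And>x y. x \<in> carrier V \<Longrightarrow> y \<in> carrier W \<Longrightarrow> f (tensor V W x y) = g (tensor V W x y)"
  shows "f X = g X"
  using X
proof (induction rule: tensor_induct)
  case zero
  then show ?case using linear_map_zero[OF f] linear_map_zero[OF g] Z by simp
qed (simp_all add: eq linear_map_add[OF f] linear_map_add[OF g] linear_map_smult[OF f] linear_map_smult[OF g])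

section \<open>Closure properties of linear maps and nested lifts\<close>

lemma linear_map_id: "linear_map V V (\<lambda>x. x)"
  by (rule linear_mapI) simp_all

lemma linear_map_compose:
  assumes g: "linear_map W Z g" and f: "linear_map V W f"
  shows "linear_map V Z (\<lambda>x. g (f x))"
  by (rule linear_mapI) (simp_all add: linear_map_closed[OF f] linear_map_closed[OF g]
      linear_map_add[OF f] linear_map_add[OF g] linear_map_smult[OF f] linear_map_smult[OF g])

lemma linear_map_add_fun:
  assumes "vspace Z" "linear_map V Z f" "linear_map V Z g"
  shows "linear_map V Z (\<lambda>x. f x \<oplus>\<^bsub>Z\<^esub> g x)"
proof -
  interpret Z: Module.module ground Z by (fact assms)
  show ?thesis
    using assms(1) by (intro linear_mapI) (simp_all add: linear_map_closed[OF assms(2)] linear_map_closed[OF assms(3)]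
      linear_map_add[OF assms(2)] linear_map_add[OF assms(3)] linear_map_smult[OF assms(2)]
      linear_map_smult[OF assms(3)] vspace_smult_add_right Z.a_ac)
qed

lemma linear_map_smult_fun:
  assumes "vspace Z" "linear_map V Z f"
  shows "linear_map V Z (\<lambda>x. c \<odot>\<^bsub>Z\<^esub> f x)"
  using assms(1) by (intro linear_mapI) (simp_all add: linear_map_closed[OF assms(2)]
      linear_map_add[OF assms(2)] linear_map_smult[OF assms(2)] vspace_smult_add_right vspace_smult_smult mult.commute)

lemma linear_map_smult_scalar:
  assumes "vspace Z" "linear_map V ground f" "z \<in> carrier Z"
  shows "linear_map V Z (\<lambda>x. f x \<odot>\<^bsub>Z\<^esub> z)"
  using assms(1,3) by (intro linear_mapI) (simp_all
      add: linear_map_add[OF assms(2)] linear_map_smult[OF assms(2)] vspace_smult_add_left vspace_smult_smult)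

lemma linear_map_const_zero: "vspace Z \<Longrightarrow> linear_map V Z (\<lambda>x. \<zero>\<^bsub>Z\<^esub>)"
proof (rule linear_mapI)
  assume "vspace Z"
  then interpret Z: Module.module ground Z .
  show "\<zero>\<^bsub>Z\<^esub> = \<zero>\<^bsub>Z\<^esub> \<oplus>\<^bsub>Z\<^esub> \<zero>\<^bsub>Z\<^esub>" by simp
qed simp_all

text \<open>The induction runs over the tensor \<open>X\<close>, not over the parameter: for an
  elementary tensor the map is p \<mapsto> \<beta> p x y, and linear maps into \<open>Z\<close> are
  closed under sums and multiples. This yields multilinearity of Sweedler sums with free variables
  in the integrand.\<close>

lemma linear_map_lift_param:
  assumes "vspace P" and V: "vspace V" and W: "vspace W" and Z: "vspace Z"
    and X: "X \<in> carrier (tensor_space V W)"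
    and \<beta>: "\<And>p. p \<in> carrier P \<Longrightarrow> bilinear_map V W Z (\<beta> p)"
    and lin: "\<And>x y. x \<in> carrier V \<Longrightarrow> y \<in> carrier W \<Longrightarrow> linear_map P Z (\<lambda>p. \<beta> p x y)"
  shows "linear_map P Z (\<lambda>p. lift Z (\<beta> p) X)"
  using X
proof (induction rule: tensor_induct)
  case (tensor x y)
  then show ?case
    using \<open>vspace P\<close> lin by (elim linear_map_cong) (simp_all add: lift_tensor[OF V W Z \<beta>])
next
  case zero
  show ?case
    using \<open>vspace P\<close> linear_map_const_zero[OF Z]
    by (rule linear_map_cong) (simp add: linear_map_zero[OF linear_map_lift[OF V W Z \<beta>]] Z)
next
  case (add X Y)
  show ?case
    using \<open>vspace P\<close> linear_map_add_fun[OF Z add.IH]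
    by (rule linear_map_cong) (simp add: linear_map_add[OF linear_map_lift[OF V W Z \<beta>]] add.hyps)
next
  case (smult c X)
  show ?case
    using \<open>vspace P\<close> linear_map_smult_fun[OF Z smult.IH]
    by (rule linear_map_cong) (simp add: linear_map_smult[OF linear_map_lift[OF V W Z \<beta>]] smult.hyps)
qed

lemma linear_map_lift_commute:
  assumes V: "vspace V" and W: "vspace W" and Z: "vspace Z" and Z': "vspace Z'"
    and f: "linear_map Z Z' f" and \<beta>: "bilinear_map V W Z \<beta>" and X: "X \<in> carrier (tensor_space V W)"
  shows "f (lift Z \<beta> X) = lift Z' (\<lambda>x y. f (\<beta> x y)) X"
proof -
  have \<beta>': "bilinear_map V W Z' (\<lambda>x y. f (\<beta> x y))"
    by (intro bilinear_mapI linear_map_compose[OF f] bilinear_map_left[OF \<beta>] bilinear_map_right[OF \<beta>])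
  show ?thesis
    by (rule linear_map_eq_on_tensors[OF linear_map_compose[OF f linear_map_lift[OF V W Z \<beta>]]
          linear_map_lift[OF V W Z' \<beta>'] Z' X])
      (simp add: lift_tensor[OF V W] Z Z' \<beta> \<beta>')
qed

text \<open>Exchange of two independent finite sums. Both sides are read as linear maps of
  \<open>X\<close>; on x \<otimes> y the lift over \<open>X\<close> collapses on each side, and the
  same lift over \<open>Y\<close> remains.\<close>

lemma lift_swap:
  assumes V: "vspace V" and W: "vspace W" and V': "vspace V'" and W': "vspace W'" and Z: "vspace Z"
    and X: "X \<in> carrier (tensor_space V W)" and Y: "Y \<in> carrier (tensor_space V' W')"
    and 1: "\<And>x y. x \<in> carrier V \<Longrightarrow> y \<in> carrier W \<Longrightarrow> bilinear_map V' W' Z (\<beta> x y)"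
    and 2: "\<And>x' y'. x' \<in> carrier V' \<Longrightarrow> y' \<in> carrier W' \<Longrightarrow> bilinear_map V W Z (\<lambda>x y. \<beta> x y x' y')"
  shows "lift Z (\<lambda>x y. lift Z (\<beta> x y) Y) X = lift Z (\<lambda>x' y'. lift Z (\<lambda>x y. \<beta> x y x' y') X) Y"
proof -
  have A: "bilinear_map V W Z (\<lambda>x y. lift Z (\<beta> x y) Y)"
    by (intro bilinear_mapI linear_map_lift_param[OF _ V' W' Z Y] V W 1
        bilinear_map_left[OF 2] bilinear_map_right[OF 2])
  have B: "bilinear_map V' W' Z (\<lambda>x' y'. lift Z (\<lambda>x y. \<beta> x y x' y') X)"
    if "X \<in> carrier (tensor_space V W)" for X
    by (intro bilinear_mapI linear_map_lift_param[OF _ V W Z that] V' W' 2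
        bilinear_map_left[OF 1] bilinear_map_right[OF 1])
  show ?thesis
  proof (rule linear_map_eq_on_tensors[OF _ _ Z X])
    show "linear_map (tensor_space V W) Z (lift Z (\<lambda>x y. lift Z (\<beta> x y) Y))"
      using V W Z A by (rule linear_map_lift)
    \<comment> \<open>Here \<open>X\<close> is a parameter in the integrand of a lift over
      \<open>Y\<close>, so linearity comes from \<open>linear_map_lift_param\<close>.\<close>
    show "linear_map (tensor_space V W) Z (\<lambda>X. lift Z (\<lambda>x' y'. lift Z (\<lambda>x y. \<beta> x y x' y') X) Y)"
    proof (rule linear_map_lift_param[OF vspace_tensor_space V' W' Z Y])
      show "bilinear_map V' W' Z (\<lambda>x' y'. lift Z (\<lambda>x y. \<beta> x y x' y') X)"
        if "X \<in> carrier (tensor_space V W)" for X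
        using that by (rule B)
      show "linear_map (tensor_space V W) Z (lift Z (\<lambda>x y. \<beta> x y x' y'))"
        if "x' \<in> carrier V'" "y' \<in> carrier W'" for x' y'
        using that by (intro linear_map_lift[OF V W Z] 2)
    qed
    show "lift Z (\<lambda>x y. lift Z (\<beta> x y) Y) (tensor V W x y) =
        lift Z (\<lambda>x' y'. lift Z (\<lambda>x y. \<beta> x y x' y') (tensor V W x y)) Y"
      if "x \<in> carrier V" "y \<in> carrier W" for x y
    proof -
      have "lift Z (\<lambda>x' y'. lift Z (\<lambda>x y. \<beta> x y x' y') (tensor V W x y)) Y = lift Z (\<beta> x y) Y"
        by (rule lift_cong[OF V' W' Z 1[OF that] Y]) (simp add: lift_tensor[OF V W Z 2] that)
      then show ?thesis
        by (simp add: lift_tensor[OF V W Z A that])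
    qed
  qed
qed


section \<open>Sweedler calculus\<close>

text \<open>\<open>tensor_bialgebra A B\<close> and \<open>tensor_space A B\<close> are records of
  different types over the same vector space. The tensor relations read only the carrier, the
  addition and the scalar action, so tensor products formed over either record can be
  identified.\<close>

lemma tensor_null_cong_subset:
  assumes "carrier V = carrier V'" "add V = add V'" "smult V = smult V'"
    and "carrier W = carrier W'" "add W = add W'" "smult W = smult W'"
  shows "tensor_null V W \<subseteq> tensor_null V' W'"
proof
  fix f assume "f \<in> tensor_null V W"
  then show "f \<in> tensor_null V' W'"
    by induction (simp_all add: assms tensor_null.intros)
qed

lemma tensor_null_cong:
  assumes "carrier V = carrier V'" "add V = add V'" "smult V = smult V'"
    and "carrier W = carrier W'" "add W = add W'" "smult W = smult W'"
  shows "tensor_null V W = tensor_null V' W'"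
  using assms by (intro equalityI tensor_null_cong_subset) simp_all

lemma
  assumes "carrier V = carrier V'" "add V = add V'" "smult V = smult V'"
    and "carrier W = carrier W'" "add W = add W'" "smult W = smult W'"
  shows tensor_cong: "tensor V W = tensor V' W'"
    and tensor_space_cong: "tensor_space V W = tensor_space V' W'"
proof -
  note * = tensor_null_cong[OF assms]
  show "tensor V W = tensor V' W'"
    by (intro ext) (simp add: tensor_def tensor_class_def *)
  show "tensor_space V W = tensor_space V' W'"
    by (simp add: tensor_space_def tensor_class_def * assms)
qed

lemma tensor_algebra_simps [simp]:
  "carrier (tensor_algebra A B) = carrier (tensor_space A B)"
  "add (tensor_algebra A B) = add (tensor_space A B)"
  "zero (tensor_algebra A B) = zero (tensor_space A B)"
  "smult (tensor_algebra A B) = smult (tensor_space A B)"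
  by (simp_all add: tensor_algebra_def)

lemma tensor_bialgebra_simps [simp]:
  "carrier (tensor_bialgebra A B) = carrier (tensor_space A B)"
  "add (tensor_bialgebra A B) = add (tensor_space A B)"
  "zero (tensor_bialgebra A B) = zero (tensor_space A B)"
  "smult (tensor_bialgebra A B) = smult (tensor_space A B)"
  "mult (tensor_bialgebra A B) = mult (tensor_algebra A B)"
  "one (tensor_bialgebra A B) = one (tensor_algebra A B)"
  "counit (tensor_bialgebra A B) = lift ground (\<lambda>a b. counit A a * counit B b)"
  by (simp_all add: tensor_bialgebra_def module.defs bialg.defs Let_def)

lemma comult_tensor_bialgebra:
  "comult (tensor_bialgebra A B) =
    lift (tensor_space (tensor_space A B) (tensor_space A B))
      (\<lambda>a b. sweedler2 A (tensor_space (tensor_space A B) (tensor_space A B)) (\<lambda>a\<^sub>1 a\<^sub>2.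
        sweedler2 B (tensor_space (tensor_space A B) (tensor_space A B)) (\<lambda>b\<^sub>1 b\<^sub>2.
          tensor (tensor_space A B) (tensor_space A B) (tensor A B a\<^sub>1 b\<^sub>1) (tensor A B a\<^sub>2 b\<^sub>2)) b) a)"
  by (simp add: tensor_bialgebra_def module.defs bialg.defs Let_def)

lemma tensor_space_tensor_bialgebra [simp]:
  "tensor_space (tensor_bialgebra A B) W = tensor_space (tensor_space A B) W"
  "tensor_space V (tensor_bialgebra A B) = tensor_space V (tensor_space A B)"
  "tensor (tensor_bialgebra A B) W = tensor (tensor_space A B) W"
  "tensor V (tensor_bialgebra A B) = tensor V (tensor_space A B)"
  by (intro tensor_space_cong tensor_cong; simp)+

lemma linear_map_tensor_bialgebra [simp]:
  "linear_map (tensor_bialgebra A B) W f \<longleftrightarrow> linear_map (tensor_space A B) W f"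
  "linear_map V (tensor_bialgebra A B) g \<longleftrightarrow> linear_map V (tensor_space A B) g"
  by (simp_all add: linear_map_def)

lemma bilinear_map_tensor_bialgebra [simp]:
  "bilinear_map (tensor_bialgebra A B) W Z \<beta> \<longleftrightarrow> bilinear_map (tensor_space A B) W Z \<beta>"
  "bilinear_map V (tensor_bialgebra A B) Y \<gamma> \<longleftrightarrow> bilinear_map V (tensor_space A B) Y \<gamma>"
  "bilinear_map V' W' (tensor_bialgebra A B) \<delta> \<longleftrightarrow> bilinear_map V' W' (tensor_space A B) \<delta>"
  by (simp_all add: bilinear_map_def)

lemma vspace_cong:
  fixes V :: "('k::field, 'a, 'm) module_scheme" and V' :: "('k, 'a, 'n) module_scheme"
  assumes eq: "carrier V' = carrier V" "add V' = add V" "zero V' = zero V" "smult V' = smult V"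
    and V: "vspace V"
  shows "vspace V'"
proof -
  interpret V: Module.module ground V by (fact V)
  show ?thesis
  proof (rule vspaceI)
    show "abelian_group V'"
      by (rule abelian_groupI) (use V in \<open>auto simp: eq V.a_ac V.l_neg intro!: bexI[of _ "\<ominus>\<^bsub>V\<^esub> x" for x]\<close>)
  qed (use V in \<open>simp_all add: eq vspace_smult_add_left vspace_smult_add_right vspace_smult_smult\<close>)
qed

lemma vspace_tensor_bialgebra [simp]: "vspace (tensor_bialgebra A B)"
  by (rule vspace_cong[of _ "tensor_space A B"]) simp_all

lemma linear_map_tensor_left:
  assumes "vspace V" "vspace W" "linear_map P V f" "y \<in> carrier W"
  shows "linear_map P (tensor_space V W) (\<lambda>p. tensor V W (f p) y)"
  by (rule linear_map_compose[OF bilinear_map_left[OF bilinear_map_tensor[OF assms(1,2)] assms(4)] assms(3)])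

lemma linear_map_tensor_right:
  assumes "vspace V" "vspace W" "x \<in> carrier V" "linear_map P W f"
  shows "linear_map P (tensor_space V W) (\<lambda>p. tensor V W x (f p))"
  by (rule linear_map_compose[OF bilinear_map_right[OF bilinear_map_tensor[OF assms(1,2)] assms(3)] assms(4)])

section \<open>Trilinear maps and the rules for Sweedler sums\<close>

definition trilinear_map ::
    "('k::field, 'a, 'm) module_scheme \<Rightarrow> ('k, 'b, 'n) module_scheme \<Rightarrow> ('k, 'c, 'o) module_scheme
      \<Rightarrow> ('k, 'z, 'p) module_scheme \<Rightarrow> ('a \<Rightarrow> 'b \<Rightarrow> 'c \<Rightarrow> 'z) \<Rightarrow> bool" where
  "trilinear_map V W X Z \<beta> \<longleftrightarrow>
     (\<forall>x\<in>carrier V. bilinear_map W X Z (\<beta> x)) \<and>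
     (\<forall>y\<in>carrier W. \<forall>z\<in>carrier X. linear_map V Z (\<lambda>x. \<beta> x y z))"

lemma trilinear_mapI:
  assumes "\<And>y z. y \<in> carrier W \<Longrightarrow> z \<in> carrier X \<Longrightarrow> linear_map V Z (\<lambda>x. \<beta> x y z)"
    and "\<And>x z. x \<in> carrier V \<Longrightarrow> z \<in> carrier X \<Longrightarrow> linear_map W Z (\<lambda>y. \<beta> x y z)"
    and "\<And>x y. x \<in> carrier V \<Longrightarrow> y \<in> carrier W \<Longrightarrow> linear_map X Z (\<lambda>z. \<beta> x y z)"
  shows "trilinear_map V W X Z \<beta>"
  using assms by (simp add: trilinear_map_def bilinear_map_def)

text \<open>Shaped for resolution: a parameter that occurs inside exactly one slot, however deeply,
  is reduced to linearity of the expression in that slot.\<close>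

lemma trilinear_map_compose:
  assumes \<beta>: "trilinear_map V W X Z \<beta>"
  shows "linear_map P V f \<Longrightarrow> y \<in> carrier W \<Longrightarrow> z \<in> carrier X \<Longrightarrow> linear_map P Z (\<lambda>p. \<beta> (f p) y z)"
    and "x \<in> carrier V \<Longrightarrow> linear_map P W g \<Longrightarrow> z \<in> carrier X \<Longrightarrow> linear_map P Z (\<lambda>p. \<beta> x (g p) z)"
    and "x \<in> carrier V \<Longrightarrow> y \<in> carrier W \<Longrightarrow> linear_map P X h \<Longrightarrow> linear_map P Z (\<lambda>p. \<beta> x y (h p))"
proof -
  show "linear_map P V f \<Longrightarrow> y \<in> carrier W \<Longrightarrow> z \<in> carrier X \<Longrightarrow> linear_map P Z (\<lambda>p. \<beta> (f p) y z)"
    using \<beta> by (intro linear_map_compose[of V Z "\<lambda>x. \<beta> x y z" P f]) (auto simp: trilinear_map_def)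
  show "x \<in> carrier V \<Longrightarrow> linear_map P W g \<Longrightarrow> z \<in> carrier X \<Longrightarrow> linear_map P Z (\<lambda>p. \<beta> x (g p) z)"
    using \<beta> by (intro linear_map_compose[of W Z "\<lambda>y. \<beta> x y z" P g]) (auto simp: trilinear_map_def bilinear_map_def)
  show "x \<in> carrier V \<Longrightarrow> y \<in> carrier W \<Longrightarrow> linear_map P X h \<Longrightarrow> linear_map P Z (\<lambda>p. \<beta> x y (h p))"
    using \<beta> by (intro linear_map_compose[of X Z "\<lambda>z. \<beta> x y z" P h]) (auto simp: trilinear_map_def bilinear_map_def)
qed

lemma bilinear_map_compose:
  assumes \<beta>: "bilinear_map V W Z \<beta>"
  shows "linear_map P V f \<Longrightarrow> y \<in> carrier W \<Longrightarrow> linear_map P Z (\<lambda>p. \<beta> (f p) y)"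
    and "x \<in> carrier V \<Longrightarrow> linear_map P W g \<Longrightarrow> linear_map P Z (\<lambda>p. \<beta> x (g p))"
  using linear_map_compose[OF bilinear_map_left[OF \<beta>], of y P f]
    linear_map_compose[OF bilinear_map_right[OF \<beta>], of x P g] by auto

text \<open>Linear structure maps alone make Sweedler sums well behaved. Separating this from the
  axioms allows the calculus to be used on \<open>tensor_bialgebra\<close> while its coassociativity
  and counit laws are still being proved.\<close>

definition precoalgebra :: "('k::field, 'a, 'm) bialg_scheme \<Rightarrow> bool" where
  "precoalgebra D \<longleftrightarrow> vspace D \<and> linear_map D (tensor_space D D) (comult D) \<and>
     linear_map D ground (counit D)"

lemma
  assumes "precoalgebra D"
  shows precoalgebra_vspace: "vspace D"
    and linear_map_comult: "linear_map D (tensor_space D D) (comult D)"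
    and linear_map_counit: "linear_map D ground (counit D)"
    and comult_closed: "d \<in> carrier D \<Longrightarrow> comult D d \<in> carrier (tensor_space D D)"
  using assms by (auto simp: precoalgebra_def intro: linear_map_closed)

lemma coalgebra_precoalgebra: "coalgebra D \<Longrightarrow> precoalgebra D"
  by (simp add: coalgebra_def precoalgebra_def)

lemma linear_map_sweedler2:
  assumes D: "precoalgebra D" and Z: "vspace Z" and "bilinear_map D D Z \<beta>" "linear_map P D f"
  shows "linear_map P Z (\<lambda>p. sweedler2 D Z \<beta> (f p))"
proof -
  note V = precoalgebra_vspace[OF D]
  show ?thesis
    unfolding sweedler2_def
    by (rule linear_map_compose[OF linear_map_lift[OF V V Z assms(3)]
          linear_map_compose[OF linear_map_comult[OF D] assms(4)]])
qed

lemma linear_map_sweedler2_param: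
  assumes "vspace P" and D: "precoalgebra D" and Z: "vspace Z" and d: "d \<in> carrier D"
    and "\<And>p. p \<in> carrier P \<Longrightarrow> bilinear_map D D Z (\<beta> p)"
    and "\<And>x y. x \<in> carrier D \<Longrightarrow> y \<in> carrier D \<Longrightarrow> linear_map P Z (\<lambda>p. \<beta> p x y)"
  shows "linear_map P Z (\<lambda>p. sweedler2 D Z (\<beta> p) d)"
  unfolding sweedler2_def
  using assms precoalgebra_vspace[OF D] by (intro linear_map_lift_param[of P D D]) (auto intro: comult_closed)

lemma sweedler2_closed:
  assumes "precoalgebra D" "vspace Z" "bilinear_map D D Z \<beta>" "d \<in> carrier D"
  shows "sweedler2 D Z \<beta> d \<in> carrier Z"
  using linear_map_closed[OF linear_map_sweedler2[OF assms(1-3) linear_map_id] assms(4)] .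

lemma sweedler2_cong:
  assumes D: "precoalgebra D" and "vspace Z" "d \<in> carrier D" "bilinear_map D D Z \<beta>"
    and "\<And>x y. x \<in> carrier D \<Longrightarrow> y \<in> carrier D \<Longrightarrow> \<beta>' x y = \<beta> x y"
  shows "sweedler2 D Z \<beta>' d = sweedler2 D Z \<beta> d"
  unfolding sweedler2_def using assms precoalgebra_vspace[OF D]
  by (intro lift_cong[of D D]) (auto intro: comult_closed)

lemma sweedler2_commute:
  assumes D: "precoalgebra D" and "vspace Z" "vspace Z'" "linear_map Z Z' f" "bilinear_map D D Z \<beta>" "d \<in> carrier D"
  shows "f (sweedler2 D Z \<beta> d) = sweedler2 D Z' (\<lambda>x y. f (\<beta> x y)) d"
  unfolding sweedler2_def using assms precoalgebra_vspace[OF D]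
  by (intro linear_map_lift_commute[of D D]) (auto intro: comult_closed)

lemma sweedler2_swap:
  assumes D: "precoalgebra D" and E: "precoalgebra E" and "vspace Z" "d \<in> carrier D" "e \<in> carrier E"
    and "\<And>x y. x \<in> carrier D \<Longrightarrow> y \<in> carrier D \<Longrightarrow> bilinear_map E E Z (\<beta> x y)"
    and "\<And>x' y'. x' \<in> carrier E \<Longrightarrow> y' \<in> carrier E \<Longrightarrow> bilinear_map D D Z (\<lambda>x y. \<beta> x y x' y')"
  shows "sweedler2 D Z (\<lambda>x y. sweedler2 E Z (\<beta> x y) e) d =
    sweedler2 E Z (\<lambda>x' y'. sweedler2 D Z (\<lambda>x y. \<beta> x y x' y') d) e"
  unfolding sweedler2_def using assms precoalgebra_vspace[OF D] precoalgebra_vspace[OF E]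
  by (intro lift_swap[of D D E E]) (auto intro: comult_closed)

text \<open>Syntax-directed rules for the multilinearity obligations: each removes one layer, such
  as a Sweedler sum, a scalar or a tensor, until only the parameter itself is left.\<close>

lemmas multilinear = bilinear_mapI trilinear_mapI linear_map_id linear_map_sweedler2 linear_map_sweedler2_param
  linear_map_smult_fun linear_map_smult_scalar linear_map_tensor_left linear_map_tensor_right
  sweedler2_closed tensor_closed

text \<open>The axiom is stated for the universal trilinear map into (D \<otimes> D) \<otimes> D.
  Any trilinear \<open>\<beta>\<close> factors through that map by a linear \<open>\<phi>\<close>,
  and \<open>\<phi>\<close> passes through both nested Sweedler sums.\<close>

lemma coalgebra_coassoc:
  assumes D: "coalgebra D" and Z: "vspace Z" and \<beta>: "trilinear_map D D D Z \<beta>" and d: "d \<in> carrier D"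
  shows "sweedler2 D Z (\<lambda>d' d\<^sub>3. sweedler2 D Z (\<lambda>d\<^sub>1 d\<^sub>2. \<beta> d\<^sub>1 d\<^sub>2 d\<^sub>3) d') d = sweedler3 D Z \<beta> d"
proof -
  note D' [simp] = coalgebra_precoalgebra[OF D]
  note V [simp] = precoalgebra_vspace[OF D']
  let ?D2 = "tensor_space D D"
  let ?D3 = "tensor_space ?D2 D"
  let ?t = "\<lambda>x y z. tensor ?D2 D (tensor D D x y) z"
  define \<phi> where "\<phi> = lift3 Z \<beta>"
  have b: "bilinear_map ?D2 D Z (\<lambda>t z. lift Z (\<lambda>x y. \<beta> x y z) t)"
    by (intro bilinear_mapI linear_map_lift linear_map_lift_param[of _ D D] V Z
        trilinear_map_compose[OF \<beta>] linear_map_id)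
  have \<phi>: "linear_map ?D3 Z \<phi>"
    unfolding \<phi>_def lift3_def by (rule linear_map_lift[OF vspace_tensor_space V Z b])
  have \<phi>t: "\<phi> (?t x y z) = \<beta> x y z" if "x \<in> carrier D" "y \<in> carrier D" "z \<in> carrier D" for x y z
    using that unfolding \<phi>_def lift3_def
    by (subst lift_tensor[OF _ _ _ b] lift_tensor;
        auto intro!: Z tensor_closed multilinear trilinear_map_compose[OF \<beta>])+
  note intros = multilinear Z D' V vspace_tensor_space trilinear_map_compose[OF \<beta>]
    linear_map_compose[OF \<phi>]
  have "sweedler2 D Z (\<lambda>d' d\<^sub>3. sweedler2 D Z (\<lambda>d\<^sub>1 d\<^sub>2. \<beta> d\<^sub>1 d\<^sub>2 d\<^sub>3) d') d =
      sweedler2 D Z (\<lambda>d' d\<^sub>3. \<phi> (sweedler2 D ?D3 (\<lambda>d\<^sub>1 d\<^sub>2. ?t d\<^sub>1 d\<^sub>2 d\<^sub>3) d')) d"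
  proof (rule sweedler2_cong[OF D' Z d])
    fix x y assume xy: "x \<in> carrier D" "y \<in> carrier D"
    have "\<phi> (sweedler2 D ?D3 (\<lambda>d\<^sub>1 d\<^sub>2. ?t d\<^sub>1 d\<^sub>2 y) x) = sweedler2 D Z (\<lambda>d\<^sub>1 d\<^sub>2. \<phi> (?t d\<^sub>1 d\<^sub>2 y)) x"
      by (rule sweedler2_commute) (auto intro!: intros \<phi> xy)
    also have "\<dots> = sweedler2 D Z (\<lambda>d\<^sub>1 d\<^sub>2. \<beta> d\<^sub>1 d\<^sub>2 y) x"
      by (rule sweedler2_cong) (auto intro!: intros xy simp: \<phi>t xy)
    finally show "sweedler2 D Z (\<lambda>d\<^sub>1 d\<^sub>2. \<beta> d\<^sub>1 d\<^sub>2 y) x = \<phi> (sweedler2 D ?D3 (\<lambda>d\<^sub>1 d\<^sub>2. ?t d\<^sub>1 d\<^sub>2 y) x)"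
      by (rule sym)
  qed (auto intro!: intros)
  also have "\<dots> = \<phi> (sweedler2 D ?D3 (\<lambda>d' d\<^sub>3. sweedler2 D ?D3 (\<lambda>d\<^sub>1 d\<^sub>2. ?t d\<^sub>1 d\<^sub>2 d\<^sub>3) d') d)"
    by (rule sweedler2_commute[symmetric]) (auto intro!: intros \<phi> d)
  also have "\<dots> = \<phi> (sweedler2 D ?D3 (\<lambda>d\<^sub>1 d'. sweedler2 D ?D3 (\<lambda>d\<^sub>2 d\<^sub>3. ?t d\<^sub>1 d\<^sub>2 d\<^sub>3) d') d)"
    using D d by (simp add: coalgebra_def Let_def)
  also have "\<dots> = sweedler2 D Z (\<lambda>d\<^sub>1 d'. \<phi> (sweedler2 D ?D3 (\<lambda>d\<^sub>2 d\<^sub>3. ?t d\<^sub>1 d\<^sub>2 d\<^sub>3) d')) d"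
    by (rule sweedler2_commute) (auto intro!: intros \<phi> d)
  also have "\<dots> = sweedler3 D Z \<beta> d"
    unfolding sweedler3_def
  proof (rule sweedler2_cong[OF D' Z d])
    fix x y assume xy: "x \<in> carrier D" "y \<in> carrier D"
    have "\<phi> (sweedler2 D ?D3 (\<lambda>d\<^sub>2 d\<^sub>3. ?t x d\<^sub>2 d\<^sub>3) y) = sweedler2 D Z (\<lambda>d\<^sub>2 d\<^sub>3. \<phi> (?t x d\<^sub>2 d\<^sub>3)) y"
      by (rule sweedler2_commute) (auto intro!: intros \<phi> xy)
    also have "\<dots> = sweedler2 D Z (\<lambda>d\<^sub>2 d\<^sub>3. \<beta> x d\<^sub>2 d\<^sub>3) y"
      by (rule sweedler2_cong) (auto intro!: intros xy simp: \<phi>t xy)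
    finally show "\<phi> (sweedler2 D ?D3 (\<lambda>d\<^sub>2 d\<^sub>3. ?t x d\<^sub>2 d\<^sub>3) y) = sweedler2 D Z (\<lambda>d\<^sub>2 d\<^sub>3. \<beta> x d\<^sub>2 d\<^sub>3) y" .
  qed (auto intro!: intros)
  finally show ?thesis .
qed

text \<open>Apply \<open>f\<close> to the counit axiom. The freedom in \<open>f\<close> allows the
  surviving leg to sit inside a larger expression, which is how the counits are removed
  later.\<close>

lemma
  assumes D: "coalgebra D" and Z: "vspace Z" and f: "linear_map D Z f" and d: "d \<in> carrier D"
  shows sweedler2_counit_left: "sweedler2 D Z (\<lambda>x y. counit D x \<odot>\<^bsub>Z\<^esub> f y) d = f d"
    and sweedler2_counit_right: "sweedler2 D Z (\<lambda>x y. counit D y \<odot>\<^bsub>Z\<^esub> f x) d = f d"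
proof -
  note D' [simp] = coalgebra_precoalgebra[OF D]
  note V [simp] = precoalgebra_vspace[OF D']
  note intros = multilinear Z D' V linear_map_compose[OF f] linear_map_compose[OF linear_map_counit[OF D']]
    linear_map_closed[OF f]
  have "sweedler2 D Z (\<lambda>x y. counit D x \<odot>\<^bsub>Z\<^esub> f y) d = f (sweedler2 D D (\<lambda>x y. counit D x \<odot>\<^bsub>D\<^esub> y) d)"
    by (subst sweedler2_commute[OF _ _ Z f])
      (auto intro!: intros d sweedler2_cong simp: linear_map_smult[OF f])
  then show "sweedler2 D Z (\<lambda>x y. counit D x \<odot>\<^bsub>Z\<^esub> f y) d = f d"
    using D d by (simp add: coalgebra_def)
  have "sweedler2 D Z (\<lambda>x y. counit D y \<odot>\<^bsub>Z\<^esub> f x) d = f (sweedler2 D D (\<lambda>x y. counit D y \<odot>\<^bsub>D\<^esub> x) d)"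
    by (subst sweedler2_commute[OF _ _ Z f])
      (auto intro!: intros d sweedler2_cong simp: linear_map_smult[OF f])
  then show "sweedler2 D Z (\<lambda>x y. counit D y \<odot>\<^bsub>Z\<^esub> f x) d = f d"
    using D d by (simp add: coalgebra_def)
qed


section \<open>Tensor products of coalgebras\<close>

lemma bilinear_map_tensor_comult:
  assumes A: "precoalgebra A" and B: "precoalgebra B"
  shows "bilinear_map A B (tensor_space (tensor_space A B) (tensor_space A B))
    (\<lambda>a b. sweedler2 A (tensor_space (tensor_space A B) (tensor_space A B)) (\<lambda>a\<^sub>1 a\<^sub>2.
      sweedler2 B (tensor_space (tensor_space A B) (tensor_space A B)) (\<lambda>b\<^sub>1 b\<^sub>2.
        tensor (tensor_space A B) (tensor_space A B) (tensor A B a\<^sub>1 b\<^sub>1) (tensor A B a\<^sub>2 b\<^sub>2)) b) a)"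
  by (auto intro!: multilinear A B precoalgebra_vspace[OF A] precoalgebra_vspace[OF B])

lemma bilinear_map_tensor_counit:
  assumes A: "precoalgebra A" and B: "precoalgebra B"
  shows "bilinear_map A B ground (\<lambda>a b. counit A a * counit B b)"
  by (auto intro!: bilinear_mapI linear_mapI precoalgebra_vspace[OF A] precoalgebra_vspace[OF B]
      simp: linear_map_add[OF linear_map_counit[OF A]] linear_map_smult[OF linear_map_counit[OF A]]
        linear_map_add[OF linear_map_counit[OF B]] linear_map_smult[OF linear_map_counit[OF B]] algebra_simps)

lemma precoalgebra_tensor_bialgebra:
  assumes A: "precoalgebra A" and B: "precoalgebra B"
  shows "precoalgebra (tensor_bialgebra A B)"
  using linear_map_lift[OF precoalgebra_vspace[OF A] precoalgebra_vspace[OF B] vspace_tensor_space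
      bilinear_map_tensor_comult[OF A B]]
    linear_map_lift[OF precoalgebra_vspace[OF A] precoalgebra_vspace[OF B] vspace_ground
      bilinear_map_tensor_counit[OF A B]]
  by (simp add: precoalgebra_def comult_tensor_bialgebra)

text \<open>The coproduct of a \<otimes> b is by construction a double Sweedler sum of elementary
  tensors. The linear map \<open>lift Z \<beta>\<close> is moved through both sums until it meets
  such a tensor and evaluates to \<open>\<beta>\<close>.\<close>

lemma sweedler2_tensor:
  assumes A: "precoalgebra A" and B: "precoalgebra B" and Z: "vspace Z"
    and \<beta>: "bilinear_map (tensor_space A B) (tensor_space A B) Z \<beta>"
    and a: "a \<in> carrier A" and b: "b \<in> carrier B"
  shows "sweedler2 (tensor_bialgebra A B) Z \<beta> (tensor A B a b) =
    sweedler2 A Z (\<lambda>a\<^sub>1 a\<^sub>2. sweedler2 B Z (\<lambda>b\<^sub>1 b\<^sub>2. \<beta> (tensor A B a\<^sub>1 b\<^sub>1) (tensor A B a\<^sub>2 b\<^sub>2)) b) a"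
proof -
  note V = precoalgebra_vspace[OF A] precoalgebra_vspace[OF B]
  let ?S = "tensor_space A B"
  let ?TT = "tensor_space ?S ?S"
  note lin = linear_map_lift[OF vspace_tensor_space vspace_tensor_space Z \<beta>]
  note intros = multilinear A B V Z vspace_tensor_space bilinear_map_compose[OF \<beta>]
  have "sweedler2 (tensor_bialgebra A B) Z \<beta> (tensor A B a b) =
      lift Z \<beta> (sweedler2 A ?TT (\<lambda>a\<^sub>1 a\<^sub>2. sweedler2 B ?TT (\<lambda>b\<^sub>1 b\<^sub>2.
        tensor ?S ?S (tensor A B a\<^sub>1 b\<^sub>1) (tensor A B a\<^sub>2 b\<^sub>2)) b) a)"
    using a b by (simp add: sweedler2_def[of "tensor_bialgebra A B"] comult_tensor_bialgebra
        lift_tensor[OF V vspace_tensor_space bilinear_map_tensor_comult[OF A B]])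
  also have "\<dots> = sweedler2 A Z (\<lambda>a\<^sub>1 a\<^sub>2. lift Z \<beta> (sweedler2 B ?TT (\<lambda>b\<^sub>1 b\<^sub>2.
        tensor ?S ?S (tensor A B a\<^sub>1 b\<^sub>1) (tensor A B a\<^sub>2 b\<^sub>2)) b)) a"
    by (rule sweedler2_commute[OF A vspace_tensor_space Z lin]) (auto intro!: intros a b)
  also have "\<dots> = sweedler2 A Z (\<lambda>a\<^sub>1 a\<^sub>2. sweedler2 B Z (\<lambda>b\<^sub>1 b\<^sub>2. \<beta> (tensor A B a\<^sub>1 b\<^sub>1) (tensor A B a\<^sub>2 b\<^sub>2)) b) a"
  proof (rule sweedler2_cong[OF A Z a])
    fix x y assume xy: "x \<in> carrier A" "y \<in> carrier A"
    have "lift Z \<beta> (sweedler2 B ?TT (\<lambda>b\<^sub>1 b\<^sub>2. tensor ?S ?S (tensor A B x b\<^sub>1) (tensor A B y b\<^sub>2)) b) =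
        sweedler2 B Z (\<lambda>b\<^sub>1 b\<^sub>2. lift Z \<beta> (tensor ?S ?S (tensor A B x b\<^sub>1) (tensor A B y b\<^sub>2))) b"
      by (rule sweedler2_commute[OF B vspace_tensor_space Z lin]) (auto intro!: intros b xy)
    also have "\<dots> = sweedler2 B Z (\<lambda>b\<^sub>1 b\<^sub>2. \<beta> (tensor A B x b\<^sub>1) (tensor A B y b\<^sub>2)) b"
      by (rule sweedler2_cong[OF B Z b])
        (auto intro!: intros xy simp: lift_tensor[OF vspace_tensor_space vspace_tensor_space Z \<beta>] tensor_closed xy)
    finally show "lift Z \<beta> (sweedler2 B ?TT (\<lambda>b\<^sub>1 b\<^sub>2. tensor ?S ?S (tensor A B x b\<^sub>1) (tensor A B y b\<^sub>2)) b) =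
        sweedler2 B Z (\<lambda>b\<^sub>1 b\<^sub>2. \<beta> (tensor A B x b\<^sub>1) (tensor A B y b\<^sub>2)) b" .
  qed (auto intro!: intros b)
  finally show ?thesis .
qed

text \<open>On an elementary tensor the legs from A and those from B can be regrouped independently,
  once the two successive splittings of the same element stand next to each other. Working with an
  arbitrary trilinear \<open>\<beta>\<close> gives the axiom as the case of the universal
  one.\<close>

lemma tensor_bialgebra_coassoc:
  fixes A :: "('k::field, 'a, 'm) bialg_scheme" and B :: "('k, 'b, 'n) bialg_scheme"
  defines "D \<equiv> tensor_bialgebra A B" and "S \<equiv> tensor_space A B"
  assumes A: "coalgebra A" and B: "coalgebra B" and Z: "vspace Z"
    and \<beta>: "trilinear_map S S S Z \<beta>" and w: "w \<in> carrier S"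
  shows "sweedler2 D Z (\<lambda>d' d\<^sub>3. sweedler2 D Z (\<lambda>d\<^sub>1 d\<^sub>2. \<beta> d\<^sub>1 d\<^sub>2 d\<^sub>3) d') w = sweedler3 D Z \<beta> w"
proof -
  note A' = coalgebra_precoalgebra[OF A] and B' = coalgebra_precoalgebra[OF B]
  have D': "precoalgebra D"
    unfolding D_def by (rule precoalgebra_tensor_bialgebra[OF A' B'])
  have DS [simp]: "linear_map D W f \<longleftrightarrow> linear_map S W f" "linear_map W' D f' \<longleftrightarrow> linear_map W' S f'"
      "carrier D = carrier S" "vspace S" "vspace D"
    for W f f' and W' :: "('k, 'w, 'x) module_scheme"
    by (simp_all add: D_def S_def)
  have t: "x \<in> carrier A \<Longrightarrow> y \<in> carrier B \<Longrightarrow> tensor A B x y \<in> carrier S"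
    "y \<in> carrier B \<Longrightarrow> linear_map P A f \<Longrightarrow> linear_map P S (\<lambda>p. tensor A B (f p) y)"
    "x \<in> carrier A \<Longrightarrow> linear_map P B g \<Longrightarrow> linear_map P S (\<lambda>p. tensor A B x (g p))" for x y P f g
    unfolding S_def using precoalgebra_vspace[OF A'] precoalgebra_vspace[OF B']
    by (auto intro: tensor_closed linear_map_tensor_left linear_map_tensor_right)
  note intros = multilinear A' B' D' precoalgebra_vspace[OF A'] precoalgebra_vspace[OF B'] Z
    trilinear_map_compose[OF \<beta>] t
  note sw_tensor = sweedler2_tensor[OF A' B' Z, folded D_def S_def]
  let ?t = "tensor A B"
  show ?thesis
  proof (rule linear_map_eq_on_tensors[OF _ _ Z w[unfolded S_def], folded S_def])
    show "linear_map S Z (\<lambda>w. sweedler2 D Z (\<lambda>d' d\<^sub>3. sweedler2 D Z (\<lambda>d\<^sub>1 d\<^sub>2. \<beta> d\<^sub>1 d\<^sub>2 d\<^sub>3) d') w)"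
      by (auto intro!: intros)
    show "linear_map S Z (\<lambda>w. sweedler3 D Z \<beta> w)"
      unfolding sweedler3_def by (auto intro!: intros)
    fix a b assume ab: "a \<in> carrier A" "b \<in> carrier B"
    let ?\<gamma> = "\<lambda>a\<^sub>1 b\<^sub>1 a\<^sub>2 b\<^sub>2 a\<^sub>3 b\<^sub>3. \<beta> (?t a\<^sub>1 b\<^sub>1) (?t a\<^sub>2 b\<^sub>2) (?t a\<^sub>3 b\<^sub>3)"
    have "sweedler2 D Z (\<lambda>d' d\<^sub>3. sweedler2 D Z (\<lambda>d\<^sub>1 d\<^sub>2. \<beta> d\<^sub>1 d\<^sub>2 d\<^sub>3) d') (?t a b) =
        sweedler2 A Z (\<lambda>a' a\<^sub>3. sweedler2 B Z (\<lambda>b' b\<^sub>3.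
          sweedler2 D Z (\<lambda>d\<^sub>1 d\<^sub>2. \<beta> d\<^sub>1 d\<^sub>2 (?t a\<^sub>3 b\<^sub>3)) (?t a' b')) b) a"
      by (rule sw_tensor) (auto intro!: intros ab)
    also have "\<dots> = sweedler2 A Z (\<lambda>a' a\<^sub>3. sweedler2 B Z (\<lambda>b' b\<^sub>3.
          sweedler2 A Z (\<lambda>a\<^sub>1 a\<^sub>2. sweedler2 B Z (\<lambda>b\<^sub>1 b\<^sub>2. ?\<gamma> a\<^sub>1 b\<^sub>1 a\<^sub>2 b\<^sub>2 a\<^sub>3 b\<^sub>3) b') a') b) a"
      by (intro sweedler2_cong[OF A'] sweedler2_cong[OF B'] sw_tensor) (auto intro!: intros ab)
    \<comment> \<open>The second splitting of \<open>a\<close> is exchanged with the first splitting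
      of \<open>b\<close>, so that the two sums over A become adjacent, as do the two over
      B.\<close>
    also have "\<dots> = sweedler2 A Z (\<lambda>a' a\<^sub>3. sweedler2 A Z (\<lambda>a\<^sub>1 a\<^sub>2. sweedler2 B Z (\<lambda>b' b\<^sub>3.
          sweedler2 B Z (\<lambda>b\<^sub>1 b\<^sub>2. ?\<gamma> a\<^sub>1 b\<^sub>1 a\<^sub>2 b\<^sub>2 a\<^sub>3 b\<^sub>3) b') b) a') a"
      by (intro sweedler2_cong[OF A'] sweedler2_swap[OF B' A']) (auto intro!: intros ab)
    also have "\<dots> = sweedler3 A Z (\<lambda>a\<^sub>1 a\<^sub>2 a\<^sub>3. sweedler2 B Z (\<lambda>b' b\<^sub>3.
          sweedler2 B Z (\<lambda>b\<^sub>1 b\<^sub>2. ?\<gamma> a\<^sub>1 b\<^sub>1 a\<^sub>2 b\<^sub>2 a\<^sub>3 b\<^sub>3) b') b) a"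
      by (rule coalgebra_coassoc[OF A Z]) (auto intro!: intros ab)
    also have "\<dots> = sweedler2 A Z (\<lambda>a\<^sub>1 a'. sweedler2 A Z (\<lambda>a\<^sub>2 a\<^sub>3. sweedler2 B Z (\<lambda>b\<^sub>1 b'.
          sweedler2 B Z (\<lambda>b\<^sub>2 b\<^sub>3. ?\<gamma> a\<^sub>1 b\<^sub>1 a\<^sub>2 b\<^sub>2 a\<^sub>3 b\<^sub>3) b') b) a') a"
      unfolding sweedler3_def
      by (intro sweedler2_cong[OF A'] coalgebra_coassoc[OF B Z, unfolded sweedler3_def])
        (auto intro!: intros ab)
    \<comment> \<open>The reverse exchange: each sum over A is again followed by its partner over B,
      so the pairs can be read as Sweedler sums over D.\<close>
    also have "\<dots> = sweedler2 A Z (\<lambda>a\<^sub>1 a'. sweedler2 B Z (\<lambda>b\<^sub>1 b'. sweedler2 A Z (\<lambda>a\<^sub>2 a\<^sub>3.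
          sweedler2 B Z (\<lambda>b\<^sub>2 b\<^sub>3. ?\<gamma> a\<^sub>1 b\<^sub>1 a\<^sub>2 b\<^sub>2 a\<^sub>3 b\<^sub>3) b') a') b) a"
      by (intro sweedler2_cong[OF A'] sweedler2_swap[OF A' B']) (auto intro!: intros ab)
    also have "\<dots> = sweedler2 A Z (\<lambda>a\<^sub>1 a'. sweedler2 B Z (\<lambda>b\<^sub>1 b'.
          sweedler2 D Z (\<lambda>d\<^sub>2 d\<^sub>3. \<beta> (?t a\<^sub>1 b\<^sub>1) d\<^sub>2 d\<^sub>3) (?t a' b')) b) a"
      by (intro sweedler2_cong[OF A'] sweedler2_cong[OF B'] sw_tensor[symmetric]) (auto intro!: intros ab)
    also have "\<dots> = sweedler3 D Z \<beta> (?t a b)"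
      unfolding sweedler3_def by (rule sw_tensor[symmetric]) (auto intro!: intros ab)
    finally show "sweedler2 D Z (\<lambda>d' d\<^sub>3. sweedler2 D Z (\<lambda>d\<^sub>1 d\<^sub>2. \<beta> d\<^sub>1 d\<^sub>2 d\<^sub>3) d') (?t a b) =
      sweedler3 D Z \<beta> (?t a b)" .
  qed
qed

text \<open>For the counit laws, \<epsilon>(a \<otimes> b) factors on elementary tensors; the inner
  sum over B absorbs the counit of B, and the outer sum over A then absorbs that of A.\<close>

lemma coalgebra_tensor_bialgebra:
  fixes A :: "('k::field, 'a, 'm) bialg_scheme" and B :: "('k, 'b, 'n) bialg_scheme"
  assumes A: "coalgebra A" and B: "coalgebra B"
  shows "coalgebra (tensor_bialgebra A B)"
proof -
  note A' = coalgebra_precoalgebra[OF A] and B' = coalgebra_precoalgebra[OF B]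
  define D where "D = tensor_bialgebra A B"
  define S where "S = tensor_space A B"
  have D': "precoalgebra D"
    unfolding D_def by (rule precoalgebra_tensor_bialgebra[OF A' B'])
  have DS: "linear_map D W f \<longleftrightarrow> linear_map S W f" "linear_map W' D f' \<longleftrightarrow> linear_map W' S f'"
      "carrier D = carrier S" "vspace S" "vspace D"
      "bilinear_map D D W \<gamma> \<longleftrightarrow> bilinear_map S S W \<gamma>"
      "c \<odot>\<^bsub>D\<^esub> x = c \<odot>\<^bsub>S\<^esub> x" "tensor_space D W = tensor_space S W" "tensor_space W D = tensor_space W S"
      "tensor D W = tensor S W" "tensor W D = tensor W S"
    for W f \<gamma> c x and W' :: "('k, 'w, 'x) module_scheme" and f'
    by (simp_all add: D_def S_def)
  note vs = precoalgebra_vspace[OF A'] precoalgebra_vspace[OF B'] DS(4)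
  note sw_tensor = sweedler2_tensor[OF A' B' vs(3), folded D_def S_def]
  have t: "x \<in> carrier A \<Longrightarrow> y \<in> carrier B \<Longrightarrow> tensor A B x y \<in> carrier S"
    "y \<in> carrier B \<Longrightarrow> linear_map P A f \<Longrightarrow> linear_map P S (\<lambda>p. tensor A B (f p) y)"
    "x \<in> carrier A \<Longrightarrow> linear_map P B g \<Longrightarrow> linear_map P S (\<lambda>p. tensor A B x (g p))" for x y P f g
    unfolding S_def using vs
    by (auto intro: tensor_closed linear_map_tensor_left linear_map_tensor_right)
  note eps = linear_map_counit[OF A'] linear_map_counit[OF B'] linear_map_counit[OF D', unfolded DS]
  note intros = multilinear A' B' D' vs vspace_tensor_space t vspace_smult_closed[OF vs(3)] eps[THEN linear_map_compose]
  have counit_t: "counit D (tensor A B a b) = counit A a * counit B b" if "a \<in> carrier A" "b \<in> carrier B" for a b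
    using that by (simp add: D_def lift_tensor[OF vs(1,2) vspace_ground bilinear_map_tensor_counit[OF A' B']])
  \<comment> \<open>The axioms take their sums in the record \<open>D\<close>, the calculation takes
    them in \<open>S\<close>. The identity is a linear map from \<open>S\<close> to
    \<open>D\<close>, and moving it through the sum changes the target record.\<close>
  have target: "sweedler2 D D \<beta> d = sweedler2 D S \<beta> d" if "bilinear_map S S S \<beta>" "d \<in> carrier S" for \<beta> d
    using sweedler2_commute[OF D' vs(3) DS(5), of "\<lambda>x. x" \<beta> d] that
    by (simp add: DS linear_map_id)
  have left: "sweedler2 D S (\<lambda>x y. counit D x \<odot>\<^bsub>S\<^esub> y) d = d" if d: "d \<in> carrier S" for d
  proof (rule linear_map_eq_on_tensors[OF _ _ vs(3) d[unfolded S_def], folded S_def])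
    show "linear_map S S (sweedler2 D S (\<lambda>x y. counit D x \<odot>\<^bsub>S\<^esub> y))"
      by (auto intro!: intros simp: DS)
    fix a b assume ab: "a \<in> carrier A" "b \<in> carrier B"
    have "sweedler2 D S (\<lambda>x y. counit D x \<odot>\<^bsub>S\<^esub> y) (tensor A B a b) =
        sweedler2 A S (\<lambda>a\<^sub>1 a\<^sub>2. sweedler2 B S (\<lambda>b\<^sub>1 b\<^sub>2. counit D (tensor A B a\<^sub>1 b\<^sub>1) \<odot>\<^bsub>S\<^esub> tensor A B a\<^sub>2 b\<^sub>2) b) a"
      by (rule sw_tensor) (auto intro!: intros ab)
    also have "\<dots> = sweedler2 A S (\<lambda>a\<^sub>1 a\<^sub>2. counit A a\<^sub>1 \<odot>\<^bsub>S\<^esub> tensor A B a\<^sub>2 b) a"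
    proof (rule sweedler2_cong[OF A' vs(3) ab(1)])
      fix x y assume xy: "x \<in> carrier A" "y \<in> carrier A"
      \<comment> \<open>The scalar is split so that the counit of B stands alone in front; the
        factor from A is absorbed into the linear map of the second leg.\<close>
      have "sweedler2 B S (\<lambda>b\<^sub>1 b\<^sub>2. counit D (tensor A B x b\<^sub>1) \<odot>\<^bsub>S\<^esub> tensor A B y b\<^sub>2) b =
          sweedler2 B S (\<lambda>b\<^sub>1 b\<^sub>2. counit B b\<^sub>1 \<odot>\<^bsub>S\<^esub> (counit A x \<odot>\<^bsub>S\<^esub> tensor A B y b\<^sub>2)) b"
        by (rule sweedler2_cong[OF B' vs(3) ab(2)])
          (auto intro!: intros xy simp: counit_t xy vspace_smult_smult[OF vs(3)] t mult.commute)
      also have "\<dots> = counit A x \<odot>\<^bsub>S\<^esub> tensor A B y b"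
        by (rule sweedler2_counit_left[OF B vs(3)]) (auto intro!: intros xy ab)
      finally show "sweedler2 B S (\<lambda>b\<^sub>1 b\<^sub>2. counit D (tensor A B x b\<^sub>1) \<odot>\<^bsub>S\<^esub> tensor A B y b\<^sub>2) b =
        counit A x \<odot>\<^bsub>S\<^esub> tensor A B y b" .
    qed (auto intro!: intros ab)
    also have "\<dots> = tensor A B a b"
      by (rule sweedler2_counit_left[OF A vs(3)]) (auto intro!: intros ab)
    finally show "sweedler2 D S (\<lambda>x y. counit D x \<odot>\<^bsub>S\<^esub> y) (tensor A B a b) = tensor A B a b" .
  qed (rule linear_map_id)
  have right: "sweedler2 D S (\<lambda>x y. counit D y \<odot>\<^bsub>S\<^esub> x) d = d" if d: "d \<in> carrier S" for d
  proof (rule linear_map_eq_on_tensors[OF _ _ vs(3) d[unfolded S_def], folded S_def])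
    show "linear_map S S (sweedler2 D S (\<lambda>x y. counit D y \<odot>\<^bsub>S\<^esub> x))"
      by (auto intro!: intros simp: DS)
    fix a b assume ab: "a \<in> carrier A" "b \<in> carrier B"
    have "sweedler2 D S (\<lambda>x y. counit D y \<odot>\<^bsub>S\<^esub> x) (tensor A B a b) =
        sweedler2 A S (\<lambda>a\<^sub>1 a\<^sub>2. sweedler2 B S (\<lambda>b\<^sub>1 b\<^sub>2. counit D (tensor A B a\<^sub>2 b\<^sub>2) \<odot>\<^bsub>S\<^esub> tensor A B a\<^sub>1 b\<^sub>1) b) a"
      by (rule sw_tensor) (auto intro!: intros ab)
    also have "\<dots> = sweedler2 A S (\<lambda>a\<^sub>1 a\<^sub>2. counit A a\<^sub>2 \<odot>\<^bsub>S\<^esub> tensor A B a\<^sub>1 b) a"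
    proof (rule sweedler2_cong[OF A' vs(3) ab(1)])
      fix x y assume xy: "x \<in> carrier A" "y \<in> carrier A"
      have "sweedler2 B S (\<lambda>b\<^sub>1 b\<^sub>2. counit D (tensor A B y b\<^sub>2) \<odot>\<^bsub>S\<^esub> tensor A B x b\<^sub>1) b =
          sweedler2 B S (\<lambda>b\<^sub>1 b\<^sub>2. counit B b\<^sub>2 \<odot>\<^bsub>S\<^esub> (counit A y \<odot>\<^bsub>S\<^esub> tensor A B x b\<^sub>1)) b"
        by (rule sweedler2_cong[OF B' vs(3) ab(2)])
          (auto intro!: intros xy simp: counit_t xy vspace_smult_smult[OF vs(3)] t mult.commute)
      also have "\<dots> = counit A y \<odot>\<^bsub>S\<^esub> tensor A B x b"
        by (rule sweedler2_counit_right[OF B vs(3)]) (auto intro!: intros xy ab)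
      finally show "sweedler2 B S (\<lambda>b\<^sub>1 b\<^sub>2. counit D (tensor A B y b\<^sub>2) \<odot>\<^bsub>S\<^esub> tensor A B x b\<^sub>1) b =
        counit A y \<odot>\<^bsub>S\<^esub> tensor A B x b" .
    qed (auto intro!: intros ab)
    also have "\<dots> = tensor A B a b"
      by (rule sweedler2_counit_right[OF A vs(3)]) (auto intro!: intros ab)
    finally show "sweedler2 D S (\<lambda>x y. counit D y \<odot>\<^bsub>S\<^esub> x) (tensor A B a b) = tensor A B a b" .
  qed (rule linear_map_id)
  have "coalgebra D"
    unfolding coalgebra_def Let_def
  proof (intro conjI ballI)
    fix d assume "d \<in> carrier D"
    then have d: "d \<in> carrier S" by (simp add: DS)
    have "bilinear_map S S S (\<lambda>x y. counit D x \<odot>\<^bsub>S\<^esub> y)" "bilinear_map S S S (\<lambda>x y. counit D y \<odot>\<^bsub>S\<^esub> x)"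
      by (auto intro!: intros)
    then show "sweedler2 D D (\<lambda>x y. counit D x \<odot>\<^bsub>D\<^esub> y) d = d" "sweedler2 D D (\<lambda>x y. counit D y \<odot>\<^bsub>D\<^esub> x) d = d"
      by (simp_all only: DS target left right d)
    let ?D2 = "tensor_space D D"
    let ?D3 = "tensor_space ?D2 D"
    let ?t = "\<lambda>x y z. tensor ?D2 D (tensor D D x y) z"
    have "trilinear_map S S S ?D3 ?t"
      unfolding DS by (auto intro!: intros)
    then show "sweedler2 D ?D3 (\<lambda>d' d\<^sub>3. sweedler2 D ?D3 (\<lambda>d\<^sub>1 d\<^sub>2. ?t d\<^sub>1 d\<^sub>2 d\<^sub>3) d') d =
        sweedler2 D ?D3 (\<lambda>d\<^sub>1 d'. sweedler2 D ?D3 (\<lambda>d\<^sub>2 d\<^sub>3. ?t d\<^sub>1 d\<^sub>2 d\<^sub>3) d') d"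
      using tensor_bialgebra_coassoc[OF A B vspace_tensor_space, folded D_def S_def] d
      unfolding sweedler3_def by blast
  qed (use D' in \<open>simp_all add: precoalgebra_def\<close>)
  then show ?thesis
    by (simp add: D_def)
qed


section \<open>Convolution and twisted multiplication\<close>

lemma linear_map_ground_times:
  fixes f :: "'a \<Rightarrow> 'k::field"
  assumes "linear_map V ground f"
  shows "linear_map V ground (\<lambda>x. f x * c)" "linear_map V ground (\<lambda>x. c * f x)"
  using assms by (auto simp: linear_map_def algebra_simps)

lemma linear_map_eq_iff_on_tensors:
  assumes "linear_map (tensor_space V W) Z f" "linear_map (tensor_space V W) Z g" "vspace Z"
  shows "(\<forall>w\<in>carrier (tensor_space V W). f w = g w) \<longleftrightarrow>
    (\<forall>x\<in>carrier V. \<forall>y\<in>carrier W. f (tensor V W x y) = g (tensor V W x y))"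
  using linear_map_eq_on_tensors[OF assms] tensor_closed by metis

lemma sweedler3_cong:
  assumes D: "precoalgebra D" and Z: "vspace Z" and d: "d \<in> carrier D" and \<beta>: "trilinear_map D D D Z \<beta>"
    and eq: "\<And>x y z. x \<in> carrier D \<Longrightarrow> y \<in> carrier D \<Longrightarrow> z \<in> carrier D \<Longrightarrow> \<beta>' x y z = \<beta> x y z"
  shows "sweedler3 D Z \<beta>' d = sweedler3 D Z \<beta> d"
  unfolding sweedler3_def
  by (intro sweedler2_cong[OF D Z])
    (auto intro!: d eq multilinear D Z precoalgebra_vspace[OF D] trilinear_map_compose[OF \<beta>])

lemma sweedler3_commute:
  assumes D: "precoalgebra D" and Z: "vspace Z" and Z': "vspace Z'" and f: "linear_map Z Z' f"
    and \<beta>: "trilinear_map D D D Z \<beta>" and d: "d \<in> carrier D"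
  shows "f (sweedler3 D Z \<beta> d) = sweedler3 D Z' (\<lambda>x y z. f (\<beta> x y z)) d"
proof -
  note intros = d multilinear D Z Z' precoalgebra_vspace[OF D] trilinear_map_compose[OF \<beta>] linear_map_compose[OF f]
  have "f (sweedler3 D Z \<beta> d) = sweedler2 D Z' (\<lambda>x x'. f (sweedler2 D Z (\<beta> x) x')) d"
    unfolding sweedler3_def by (rule sweedler2_commute[OF D Z Z' f]) (auto intro!: intros)
  also have "\<dots> = sweedler3 D Z' (\<lambda>x y z. f (\<beta> x y z)) d"
    unfolding sweedler3_def
    by (intro sweedler2_cong[OF D Z'] sweedler2_commute[OF D Z Z' f]) (auto intro!: intros)
  finally show ?thesis .
qed

text \<open>Functionals on \<open>C\<close> act by convolution on linear maps C \<rightarrow> Z.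
  Coassociativity gives f * (g * K) = (f * g) * K, the assumption replaces f * g by the counit, and
  the counit law leaves \<open>K\<close>.\<close>

lemma convolution_cancel_left:
  assumes C: "coalgebra C" and Z: "vspace Z"
    and f: "linear_map C ground f" and g: "linear_map C ground g" and K: "linear_map C Z K"
    and inv: "\<And>w. w \<in> carrier C \<Longrightarrow> convolution C f g w = counit C w"
    and w: "w \<in> carrier C"
  shows "sweedler2 C Z (\<lambda>x x'. f x \<odot>\<^bsub>Z\<^esub> sweedler2 C Z (\<lambda>y z. g y \<odot>\<^bsub>Z\<^esub> K z) x') w = K w"
proof -
  note C' = coalgebra_precoalgebra[OF C]
  note V = precoalgebra_vspace[OF C']
  note intros = multilinear C' Z V vspace_ground linear_map_ground_times linear_map_compose[OF f]
    linear_map_compose[OF g] linear_map_compose[OF K] linear_map_closed[OF K] vspace_smult_closed[OF Z]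
    linear_map_compose[OF linear_map_counit[OF C']]
  have "sweedler2 C Z (\<lambda>x x'. f x \<odot>\<^bsub>Z\<^esub> sweedler2 C Z (\<lambda>y z. g y \<odot>\<^bsub>Z\<^esub> K z) x') w =
      sweedler3 C Z (\<lambda>x y z. (f x * g y) \<odot>\<^bsub>Z\<^esub> K z) w"
    unfolding sweedler3_def
  proof (rule sweedler2_cong[OF C' Z w])
    fix x x' assume x: "x \<in> carrier C" "x' \<in> carrier C"
    have "f x \<odot>\<^bsub>Z\<^esub> sweedler2 C Z (\<lambda>y z. g y \<odot>\<^bsub>Z\<^esub> K z) x' =
        sweedler2 C Z (\<lambda>y z. f x \<odot>\<^bsub>Z\<^esub> (g y \<odot>\<^bsub>Z\<^esub> K z)) x'"
      by (rule sweedler2_commute[OF C' Z Z]) (auto intro!: intros x)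
    also have "\<dots> = sweedler2 C Z (\<lambda>y z. (f x * g y) \<odot>\<^bsub>Z\<^esub> K z) x'"
      by (rule sweedler2_cong[OF C' Z])
        (auto intro!: intros x vspace_smult_smult[OF Z] linear_map_closed[OF K])
    finally show "f x \<odot>\<^bsub>Z\<^esub> sweedler2 C Z (\<lambda>y z. g y \<odot>\<^bsub>Z\<^esub> K z) x' =
      sweedler2 C Z (\<lambda>y z. (f x * g y) \<odot>\<^bsub>Z\<^esub> K z) x'" .
  qed (auto intro!: intros)
  \<comment> \<open>Coassociativity regroups the legs so that \<open>f\<close> and \<open>g\<close>
    share one splitting, which is their convolution.\<close>
  also have "\<dots> = sweedler2 C Z (\<lambda>w' z. sweedler2 C Z (\<lambda>x y. (f x * g y) \<odot>\<^bsub>Z\<^esub> K z) w') w"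
    by (rule coalgebra_coassoc[OF C Z _ w, symmetric]) (auto intro!: intros)
  also have "\<dots> = sweedler2 C Z (\<lambda>w' z. counit C w' \<odot>\<^bsub>Z\<^esub> K z) w"
  proof (rule sweedler2_cong[OF C' Z w])
    fix w' z assume w': "w' \<in> carrier C" and z: "z \<in> carrier C"
    have "sweedler2 C Z (\<lambda>x y. (f x * g y) \<odot>\<^bsub>Z\<^esub> K z) w' = convolution C f g w' \<odot>\<^bsub>Z\<^esub> K z"
      unfolding convolution_def
      by (rule sweedler2_commute[OF C' vspace_ground Z, symmetric]) (auto intro!: intros w' z)
    then show "sweedler2 C Z (\<lambda>x y. (f x * g y) \<odot>\<^bsub>Z\<^esub> K z) w' = counit C w' \<odot>\<^bsub>Z\<^esub> K z"
      by (simp add: inv w')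
  qed (auto intro!: intros)
  also have "\<dots> = K w"
    by (rule sweedler2_counit_left[OF C Z K w])
  finally show ?thesis .
qed

text \<open>With R = H * J the claim reads: J' * R = K iff J * K = R. From left to right this is
  cancellation with J * J' = \<epsilon>, from right to left with J' * J = \<epsilon>; both sides of
  the inverse are used.\<close>

lemma convolution_conjugate_iff:
  assumes C: "coalgebra C" and Z: "vspace Z"
    and J: "linear_map C ground J" and inv: "is_conv_inverse C J J'"
    and H: "linear_map C Z H" and K: "linear_map C Z K"
  shows "(\<forall>w\<in>carrier C. sweedler3 C Z (\<lambda>u v w. (J' u * J w) \<odot>\<^bsub>Z\<^esub> H v) w = K w) \<longleftrightarrow>
    (\<forall>w\<in>carrier C. sweedler2 C Z (\<lambda>u v. J u \<odot>\<^bsub>Z\<^esub> K v) w = sweedler2 C Z (\<lambda>u v. J v \<odot>\<^bsub>Z\<^esub> H u) w)"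
proof -
  note C' = coalgebra_precoalgebra[OF C]
  note V = precoalgebra_vspace[OF C']
  have J': "linear_map C ground J'" and inv1: "\<And>w. w \<in> carrier C \<Longrightarrow> convolution C J J' w = counit C w"
    and inv2: "\<And>w. w \<in> carrier C \<Longrightarrow> convolution C J' J w = counit C w"
    using inv by (auto simp: is_conv_inverse_def)
  note intros = multilinear C' Z V vspace_ground linear_map_ground_times linear_map_compose[OF J]
    linear_map_compose[OF J'] linear_map_compose[OF K] linear_map_compose[OF H]
    linear_map_closed[OF K] linear_map_closed[OF H] vspace_smult_closed[OF Z]
  define R where "R = (\<lambda>w. sweedler2 C Z (\<lambda>u v. J v \<odot>\<^bsub>Z\<^esub> H u) w)"
  have R: "linear_map C Z R"
    unfolding R_def by (auto intro!: intros)
  \<comment> \<open>\<open>sweedler3\<close> nests to the right, so splitting off its first leg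
    already leaves \<open>J'\<close> acting on \<open>R\<close>; the scalar \<open>J' x\<close>
    merely moves out of the inner sum.\<close>
  have conj: "sweedler3 C Z (\<lambda>u v w. (J' u * J w) \<odot>\<^bsub>Z\<^esub> H v) w = sweedler2 C Z (\<lambda>u v. J' u \<odot>\<^bsub>Z\<^esub> R v) w"
    if w: "w \<in> carrier C" for w
    unfolding sweedler3_def
  proof (rule sweedler2_cong[OF C' Z w])
    fix x x' assume x: "x \<in> carrier C" "x' \<in> carrier C"
    have "J' x \<odot>\<^bsub>Z\<^esub> R x' = sweedler2 C Z (\<lambda>y z. J' x \<odot>\<^bsub>Z\<^esub> (J z \<odot>\<^bsub>Z\<^esub> H y)) x'"
      unfolding R_def by (rule sweedler2_commute[OF C' Z Z]) (auto intro!: intros x)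
    also have "\<dots> = sweedler2 C Z (\<lambda>y z. (J' x * J z) \<odot>\<^bsub>Z\<^esub> H y) x'"
      by (rule sweedler2_cong[OF C' Z])
        (auto intro!: intros x vspace_smult_smult[OF Z] linear_map_closed[OF H])
    finally show "sweedler2 C Z (\<lambda>y z. (J' x * J z) \<odot>\<^bsub>Z\<^esub> H y) x' = J' x \<odot>\<^bsub>Z\<^esub> R x'"
      by (rule sym)
  qed (auto intro!: intros linear_map_compose[OF R] linear_map_closed[OF R])
  have "sweedler2 C Z (\<lambda>u v. J u \<odot>\<^bsub>Z\<^esub> K v) w = R w"
    if eq: "\<forall>w\<in>carrier C. sweedler2 C Z (\<lambda>u v. J' u \<odot>\<^bsub>Z\<^esub> R v) w = K w" and w: "w \<in> carrier C" for w
  proof -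
    have "sweedler2 C Z (\<lambda>u v. J u \<odot>\<^bsub>Z\<^esub> K v) w =
        sweedler2 C Z (\<lambda>x x'. J x \<odot>\<^bsub>Z\<^esub> sweedler2 C Z (\<lambda>y z. J' y \<odot>\<^bsub>Z\<^esub> R z) x') w"
      by (rule sweedler2_cong[OF C' Z w])
        (auto intro!: intros linear_map_compose[OF R] linear_map_closed[OF R] simp: eq)
    also have "\<dots> = R w"
      by (rule convolution_cancel_left[OF C Z J J' R inv1 w])
    finally show ?thesis .
  qed
  moreover have "sweedler2 C Z (\<lambda>u v. J' u \<odot>\<^bsub>Z\<^esub> R v) w = K w"
    if eq: "\<forall>w\<in>carrier C. sweedler2 C Z (\<lambda>u v. J u \<odot>\<^bsub>Z\<^esub> K v) w = R w" and w: "w \<in> carrier C" for w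
  proof -
    have "sweedler2 C Z (\<lambda>u v. J' u \<odot>\<^bsub>Z\<^esub> R v) w =
        sweedler2 C Z (\<lambda>x x'. J' x \<odot>\<^bsub>Z\<^esub> sweedler2 C Z (\<lambda>y z. J y \<odot>\<^bsub>Z\<^esub> K z) x') w"
      by (rule sweedler2_cong[OF C' Z w])
        (auto intro!: intros linear_map_compose[OF R] linear_map_closed[OF R] simp: eq)
    also have "\<dots> = K w"
      by (rule convolution_cancel_left[OF C Z J' J K inv2 w])
    finally show ?thesis .
  qed
  ultimately show ?thesis
    by (auto simp: conj simp flip: R_def)
qed

text \<open>The twisted product splits x and y in two separate triple sums, while conjugation by
  \<open>J\<close> splits x \<otimes> y in a single one. Reordering the sums pairs legs of equal
  index. The chosen inverse must be linear for this, and \<open>is_conv_inverse\<close> provides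
  that.\<close>

lemma linear_map_twisted_mult:
  assumes D: "coalgebra D" and \<mu>: "bilinear_map D D D (mult D)" and Z: "vspace Z"
    and \<phi>: "linear_map D Z \<phi>" and J: "linear_map (tensor_space D D) ground J"
    and inv: "is_conv_inverse (tensor_bialgebra D D) J (conv_inverse (tensor_bialgebra D D) J)"
    and x: "x \<in> carrier D" and y: "y \<in> carrier D"
  shows "\<phi> (twisted_mult D J x y) =
    sweedler3 (tensor_bialgebra D D) Z (\<lambda>u v w. (conv_inverse (tensor_bialgebra D D) J u * J w) \<odot>\<^bsub>Z\<^esub>
      lift Z (\<lambda>x y. \<phi> (x \<otimes>\<^bsub>D\<^esub> y)) v) (tensor D D x y)"
proof -
  let ?C = "tensor_bialgebra D D"
  define J' where "J' = conv_inverse ?C J"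
  define H where "H = lift Z (\<lambda>x y. \<phi> (x \<otimes>\<^bsub>D\<^esub> y))"
  note D' = coalgebra_precoalgebra[OF D]
  note V = precoalgebra_vspace[OF D']
  have C': "precoalgebra ?C"
    by (rule precoalgebra_tensor_bialgebra[OF D' D'])
  have J': "linear_map (tensor_space D D) ground J'"
    using inv by (simp add: is_conv_inverse_def J'_def)
  have \<mu>\<phi>: "bilinear_map D D Z (\<lambda>x y. \<phi> (x \<otimes>\<^bsub>D\<^esub> y))"
    by (intro bilinear_mapI linear_map_compose[OF \<phi>] bilinear_map_left[OF \<mu>] bilinear_map_right[OF \<mu>])
  have H: "linear_map (tensor_space D D) Z H"
    unfolding H_def by (rule linear_map_lift[OF V V Z \<mu>\<phi>])
  have H_tensor: "H (tensor D D x y) = \<phi> (x \<otimes>\<^bsub>D\<^esub> y)" if "x \<in> carrier D" "y \<in> carrier D" for x y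
    unfolding H_def by (rule lift_tensor[OF V V Z \<mu>\<phi> that])
  note intros = multilinear D' C' V Z vspace_tensor_space vspace_tensor_bialgebra linear_map_ground_times
    linear_map_compose[OF J] linear_map_compose[OF J'] linear_map_compose[OF H] linear_map_compose[OF \<phi>]
    bilinear_map_compose[OF \<mu>] bilinear_map_closed[OF \<mu>] linear_map_closed[OF H] linear_map_closed[OF \<phi>]
    vspace_smult_closed[OF V] vspace_smult_closed[OF Z] x y
  let ?t = "tensor D D"
  let ?G = "\<lambda>x\<^sub>1 y\<^sub>1 x\<^sub>2 y\<^sub>2 x\<^sub>3 y\<^sub>3. (J' (?t x\<^sub>1 y\<^sub>1) * J (?t x\<^sub>3 y\<^sub>3)) \<odot>\<^bsub>Z\<^esub> \<phi> (x\<^sub>2 \<otimes>\<^bsub>D\<^esub> y\<^sub>2)"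
  let ?G' = "\<lambda>x\<^sub>1 y\<^sub>1 x\<^sub>2 y\<^sub>2 x\<^sub>3 y\<^sub>3. (J' (?t x\<^sub>1 y\<^sub>1) * J (?t x\<^sub>3 y\<^sub>3)) \<odot>\<^bsub>D\<^esub> (x\<^sub>2 \<otimes>\<^bsub>D\<^esub> y\<^sub>2)"
  have "\<phi> (twisted_mult D J x y) =
      \<phi> (sweedler3 D D (\<lambda>x\<^sub>1 x\<^sub>2 x\<^sub>3. sweedler3 D D (\<lambda>y\<^sub>1 y\<^sub>2 y\<^sub>3. ?G' x\<^sub>1 y\<^sub>1 x\<^sub>2 y\<^sub>2 x\<^sub>3 y\<^sub>3) y) x)"
    by (simp add: twisted_mult_def J'_def)
  also have "\<dots> = sweedler3 D Z (\<lambda>x\<^sub>1 x\<^sub>2 x\<^sub>3. \<phi> (sweedler3 D D (\<lambda>y\<^sub>1 y\<^sub>2 y\<^sub>3. ?G' x\<^sub>1 y\<^sub>1 x\<^sub>2 y\<^sub>2 x\<^sub>3 y\<^sub>3) y)) x"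
    by (rule sweedler3_commute[OF D' V Z \<phi>]) (auto intro!: intros simp: sweedler3_def)
  also have "\<dots> = sweedler3 D Z (\<lambda>x\<^sub>1 x\<^sub>2 x\<^sub>3. sweedler3 D Z (\<lambda>y\<^sub>1 y\<^sub>2 y\<^sub>3. \<phi> (?G' x\<^sub>1 y\<^sub>1 x\<^sub>2 y\<^sub>2 x\<^sub>3 y\<^sub>3)) y) x"
    by (intro sweedler3_cong[OF D' Z] sweedler3_commute[OF D' V Z \<phi>])
      (auto intro!: intros simp: sweedler3_def)
  also have "\<dots> = sweedler3 D Z (\<lambda>x\<^sub>1 x\<^sub>2 x\<^sub>3. sweedler3 D Z (\<lambda>y\<^sub>1 y\<^sub>2 y\<^sub>3. ?G x\<^sub>1 y\<^sub>1 x\<^sub>2 y\<^sub>2 x\<^sub>3 y\<^sub>3) y) x"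
    by (intro sweedler3_cong[OF D' Z] linear_map_smult[OF \<phi>])
      (auto intro!: intros simp: sweedler3_def)
  \<comment> \<open>The second splitting of \<open>x\<close> is exchanged with the first splitting
    of \<open>y\<close>, which brings the order into the one of iterated splittings of x \<otimes>
    y.\<close>
  also have "\<dots> = sweedler2 D Z (\<lambda>x\<^sub>1 x'. sweedler2 D Z (\<lambda>y\<^sub>1 y'. sweedler2 D Z (\<lambda>x\<^sub>2 x\<^sub>3.
      sweedler2 D Z (\<lambda>y\<^sub>2 y\<^sub>3. ?G x\<^sub>1 y\<^sub>1 x\<^sub>2 y\<^sub>2 x\<^sub>3 y\<^sub>3) y') x') y) x"
    unfolding sweedler3_def
    by (intro sweedler2_cong[OF D' Z] sweedler2_swap[OF D' D' Z]) (auto intro!: intros)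
  also have "\<dots> = sweedler2 D Z (\<lambda>x\<^sub>1 x'. sweedler2 D Z (\<lambda>y\<^sub>1 y'. sweedler2 D Z (\<lambda>x\<^sub>2 x\<^sub>3.
      sweedler2 D Z (\<lambda>y\<^sub>2 y\<^sub>3. (J' (?t x\<^sub>1 y\<^sub>1) * J (?t x\<^sub>3 y\<^sub>3)) \<odot>\<^bsub>Z\<^esub> H (?t x\<^sub>2 y\<^sub>2)) y') x') y) x"
    by (intro sweedler2_cong[OF D' Z]) (auto intro!: intros simp: H_tensor)
  also have "\<dots> = sweedler2 D Z (\<lambda>x\<^sub>1 x'. sweedler2 D Z (\<lambda>y\<^sub>1 y'.
      sweedler2 ?C Z (\<lambda>v w. (J' (?t x\<^sub>1 y\<^sub>1) * J w) \<odot>\<^bsub>Z\<^esub> H v) (?t x' y')) y) x"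
    by (intro sweedler2_cong[OF D' Z] sweedler2_tensor[OF D' D' Z, symmetric]) (auto intro!: intros)
  also have "\<dots> = sweedler3 ?C Z (\<lambda>u v w. (J' u * J w) \<odot>\<^bsub>Z\<^esub> H v) (?t x y)"
    unfolding sweedler3_def
    by (rule sweedler2_tensor[OF D' D' Z, symmetric]) (auto intro!: intros)
  finally show ?thesis
    by (simp add: J'_def H_def)
qed

lemma
  assumes "unital_algebra A"
  shows unital_algebra_vspace: "vspace A"
    and unital_algebra_ring: "ring A"
    and bilinear_map_mult: "bilinear_map A A A (mult A)"
proof -
  interpret A: ring A using assms by (simp add: unital_algebra_def)
  show "vspace A" "ring A" "bilinear_map A A A (mult A)"
    using assms by (auto simp: unital_algebra_def A.l_distr A.r_distr intro!: bilinear_mapI linear_mapI)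
qed

text \<open>Multiplicativity is an equation on pairs, that is on elementary tensors, whereas
  cancelling \<open>J\<close> needs it at all Sweedler legs and hence on the whole of D \<otimes> D.
  Linearity bridges the gap before and after the cancellation.\<close>

lemma twisted_mult_hom_iff:
  assumes D: "coalgebra D" and \<mu>: "bilinear_map D D D (mult D)" and U: "unital_algebra U"
    and \<phi>: "linear_map D U \<phi>" and J: "linear_map (tensor_space D D) ground J"
    and inv: "\<exists>g. is_conv_inverse (tensor_bialgebra D D) J g"
  shows "(\<forall>x\<in>carrier D. \<forall>y\<in>carrier D. \<phi> (twisted_mult D J x y) = \<phi> x \<otimes>\<^bsub>U\<^esub> \<phi> y) \<longleftrightarrow>
    (\<forall>x\<in>carrier D. \<forall>y\<in>carrier D.
      sweedler2 D U (\<lambda>x\<^sub>1 x\<^sub>2. sweedler2 D U (\<lambda>y\<^sub>1 y\<^sub>2. J (tensor D D x\<^sub>1 y\<^sub>1) \<odot>\<^bsub>U\<^esub> (\<phi> x\<^sub>2 \<otimes>\<^bsub>U\<^esub> \<phi> y\<^sub>2)) y) x =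
      sweedler2 D U (\<lambda>x\<^sub>1 x\<^sub>2. sweedler2 D U (\<lambda>y\<^sub>1 y\<^sub>2. J (tensor D D x\<^sub>2 y\<^sub>2) \<odot>\<^bsub>U\<^esub> \<phi> (x\<^sub>1 \<otimes>\<^bsub>D\<^esub> y\<^sub>1)) y) x)"
proof -
  let ?C = "tensor_bialgebra D D"
  let ?t = "tensor D D"
  define J' where "J' = conv_inverse ?C J"
  \<comment> \<open>\<open>conv_inverse\<close> is a Hilbert choice, and the existence of some
    inverse makes the chosen functional one.\<close>
  have inv': "is_conv_inverse ?C J J'"
    unfolding J'_def conv_inverse_def using inv by (rule someI_ex)
  note D' = coalgebra_precoalgebra[OF D]
  note V = precoalgebra_vspace[OF D']
  note Z = unital_algebra_vspace[OF U]
  have C: "coalgebra ?C"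
    by (rule coalgebra_tensor_bialgebra[OF D D])
  note C' = coalgebra_precoalgebra[OF C]
  have J': "linear_map (tensor_space D D) ground J'"
    using inv' by (simp add: is_conv_inverse_def)
  note mU = bilinear_map_mult[OF U]
  have \<mu>\<phi>: "bilinear_map D D U (\<lambda>x y. \<phi> (x \<otimes>\<^bsub>D\<^esub> y))"
    by (intro bilinear_mapI linear_map_compose[OF \<phi>] bilinear_map_left[OF \<mu>] bilinear_map_right[OF \<mu>])
  have \<phi>\<phi>: "bilinear_map D D U (\<lambda>x y. \<phi> x \<otimes>\<^bsub>U\<^esub> \<phi> y)"
    by (intro bilinear_mapI bilinear_map_compose[OF mU] \<phi>) (auto intro: linear_map_closed[OF \<phi>])
  define H where "H = lift U (\<lambda>x y. \<phi> (x \<otimes>\<^bsub>D\<^esub> y))"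
  define K where "K = lift U (\<lambda>x y. \<phi> x \<otimes>\<^bsub>U\<^esub> \<phi> y)"
  have H: "linear_map (tensor_space D D) U H" and K: "linear_map (tensor_space D D) U K"
    unfolding H_def K_def by (rule linear_map_lift[OF V V Z] \<mu>\<phi> \<phi>\<phi>)+
  have H_tensor: "H (?t x y) = \<phi> (x \<otimes>\<^bsub>D\<^esub> y)" and K_tensor: "K (?t x y) = \<phi> x \<otimes>\<^bsub>U\<^esub> \<phi> y"
    if "x \<in> carrier D" "y \<in> carrier D" for x y
    unfolding H_def K_def by (rule lift_tensor[OF V V Z _ that] \<mu>\<phi> \<phi>\<phi>)+
  note intros = multilinear D' C' V Z vspace_tensor_space vspace_tensor_bialgebra linear_map_ground_times
    linear_map_compose[OF J] linear_map_compose[OF J'] linear_map_compose[OF H] linear_map_compose[OF K]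
    linear_map_compose[OF \<phi>] bilinear_map_compose[OF \<mu>] bilinear_map_compose[OF \<phi>\<phi>]
    linear_map_closed[OF H] linear_map_closed[OF K] bilinear_map_closed[OF \<mu>\<phi>] bilinear_map_closed[OF \<phi>\<phi>]
    vspace_smult_closed[OF Z]
  have left: "sweedler2 ?C U (\<lambda>u v. J u \<odot>\<^bsub>U\<^esub> K v) (?t x y) =
      sweedler2 D U (\<lambda>x\<^sub>1 x\<^sub>2. sweedler2 D U (\<lambda>y\<^sub>1 y\<^sub>2. J (?t x\<^sub>1 y\<^sub>1) \<odot>\<^bsub>U\<^esub> (\<phi> x\<^sub>2 \<otimes>\<^bsub>U\<^esub> \<phi> y\<^sub>2)) y) x"
    if xy: "x \<in> carrier D" "y \<in> carrier D" for x y
  proof -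
    have "sweedler2 ?C U (\<lambda>u v. J u \<odot>\<^bsub>U\<^esub> K v) (?t x y) =
        sweedler2 D U (\<lambda>x\<^sub>1 x\<^sub>2. sweedler2 D U (\<lambda>y\<^sub>1 y\<^sub>2. J (?t x\<^sub>1 y\<^sub>1) \<odot>\<^bsub>U\<^esub> K (?t x\<^sub>2 y\<^sub>2)) y) x"
      by (rule sweedler2_tensor[OF D' D' Z]) (auto intro!: intros xy)
    also have "\<dots> = sweedler2 D U (\<lambda>x\<^sub>1 x\<^sub>2. sweedler2 D U (\<lambda>y\<^sub>1 y\<^sub>2. J (?t x\<^sub>1 y\<^sub>1) \<odot>\<^bsub>U\<^esub> (\<phi> x\<^sub>2 \<otimes>\<^bsub>U\<^esub> \<phi> y\<^sub>2)) y) x"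
      by (intro sweedler2_cong[OF D' Z]) (auto intro!: intros xy simp: K_tensor)
    finally show ?thesis .
  qed
  have right: "sweedler2 ?C U (\<lambda>u v. J v \<odot>\<^bsub>U\<^esub> H u) (?t x y) =
      sweedler2 D U (\<lambda>x\<^sub>1 x\<^sub>2. sweedler2 D U (\<lambda>y\<^sub>1 y\<^sub>2. J (?t x\<^sub>2 y\<^sub>2) \<odot>\<^bsub>U\<^esub> \<phi> (x\<^sub>1 \<otimes>\<^bsub>D\<^esub> y\<^sub>1)) y) x"
    if xy: "x \<in> carrier D" "y \<in> carrier D" for x y
  proof -
    have "sweedler2 ?C U (\<lambda>u v. J v \<odot>\<^bsub>U\<^esub> H u) (?t x y) =
        sweedler2 D U (\<lambda>x\<^sub>1 x\<^sub>2. sweedler2 D U (\<lambda>y\<^sub>1 y\<^sub>2. J (?t x\<^sub>2 y\<^sub>2) \<odot>\<^bsub>U\<^esub> H (?t x\<^sub>1 y\<^sub>1)) y) x"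
      by (rule sweedler2_tensor[OF D' D' Z]) (auto intro!: intros xy)
    also have "\<dots> = sweedler2 D U (\<lambda>x\<^sub>1 x\<^sub>2. sweedler2 D U (\<lambda>y\<^sub>1 y\<^sub>2. J (?t x\<^sub>2 y\<^sub>2) \<odot>\<^bsub>U\<^esub> \<phi> (x\<^sub>1 \<otimes>\<^bsub>D\<^esub> y\<^sub>1)) y) x"
      by (intro sweedler2_cong[OF D' Z]) (auto intro!: intros xy simp: H_tensor)
    finally show ?thesis .
  qed
  have "(\<forall>x\<in>carrier D. \<forall>y\<in>carrier D. \<phi> (twisted_mult D J x y) = \<phi> x \<otimes>\<^bsub>U\<^esub> \<phi> y) \<longleftrightarrow>
      (\<forall>x\<in>carrier D. \<forall>y\<in>carrier D.
        sweedler3 ?C U (\<lambda>u v w. (J' u * J w) \<odot>\<^bsub>U\<^esub> H v) (?t x y) = K (?t x y))"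
    using linear_map_twisted_mult[OF D \<mu> Z \<phi> J, folded J'_def H_def] inv'
    by (auto simp: K_tensor)
  also have "\<dots> \<longleftrightarrow> (\<forall>w\<in>carrier ?C. sweedler3 ?C U (\<lambda>u v w. (J' u * J w) \<odot>\<^bsub>U\<^esub> H v) w = K w)"
    unfolding tensor_bialgebra_simps(1)
    by (rule linear_map_eq_iff_on_tensors[symmetric]) (auto intro!: intros K simp: sweedler3_def)
  also have "\<dots> \<longleftrightarrow> (\<forall>w\<in>carrier ?C.
      sweedler2 ?C U (\<lambda>u v. J u \<odot>\<^bsub>U\<^esub> K v) w = sweedler2 ?C U (\<lambda>u v. J v \<odot>\<^bsub>U\<^esub> H u) w)"
    using J H K by (intro convolution_conjugate_iff[OF C Z _ inv']) simp_all
  also have "\<dots> \<longleftrightarrow> (\<forall>x\<in>carrier D. \<forall>y\<in>carrier D.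
      sweedler2 ?C U (\<lambda>u v. J u \<odot>\<^bsub>U\<^esub> K v) (?t x y) = sweedler2 ?C U (\<lambda>u v. J v \<odot>\<^bsub>U\<^esub> H u) (?t x y))"
    unfolding tensor_bialgebra_simps(1)
    by (rule linear_map_eq_iff_on_tensors) (auto intro!: intros)
  finally show ?thesis
    by (simp add: left right)
qed


section \<open>Tensor products of algebras\<close>

context
  fixes A :: "('k::field, 'a, 'm) bialg_scheme" and B :: "('k, 'b, 'n) bialg_scheme"
    and U :: "('k, 'u, 'p) module_scheme" and f g G
  assumes A: "coalgebra A" and B: "coalgebra B" and U: "unital_algebra U"
    and f: "linear_map A U f" and g: "linear_map B U g"
    and G1: "\<And>c\<^sub>1 c\<^sub>2. c\<^sub>1 \<in> carrier A \<Longrightarrow> c\<^sub>2 \<in> carrier A \<Longrightarrow> bilinear_map B B U (\<lambda>b\<^sub>1 b\<^sub>2. G b\<^sub>1 b\<^sub>2 c\<^sub>1 c\<^sub>2)"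
    and G2: "\<And>b\<^sub>1 b\<^sub>2. b\<^sub>1 \<in> carrier B \<Longrightarrow> b\<^sub>2 \<in> carrier B \<Longrightarrow> bilinear_map A A U (G b\<^sub>1 b\<^sub>2)"
begin

lemmas counit_intros = multilinear coalgebra_precoalgebra[OF A] coalgebra_precoalgebra[OF B]
  precoalgebra_vspace[OF coalgebra_precoalgebra[OF A]] precoalgebra_vspace[OF coalgebra_precoalgebra[OF B]]
  unital_algebra_vspace[OF U] vspace_ground linear_map_ground_times
  linear_map_compose[OF f] linear_map_compose[OF g] linear_map_closed[OF f] linear_map_closed[OF g]
  linear_map_compose[OF linear_map_counit[OF coalgebra_precoalgebra[OF A]]]
  linear_map_compose[OF linear_map_counit[OF coalgebra_precoalgebra[OF B]]]
  bilinear_map_compose[OF G1] bilinear_map_compose[OF G2] bilinear_map_closed[OF G2]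
  bilinear_map_compose[OF bilinear_map_mult[OF U]] bilinear_map_closed[OF bilinear_map_mult[OF U]]
  vspace_smult_closed[OF unital_algebra_vspace[OF U]]

text \<open>Scaling and multiplication by fixed elements of \<open>U\<close> on either side compose
  to a linear map \<open>h\<close>, which passes through both sums.\<close>

lemma sweedler2_pull_out:
  assumes b: "b \<in> carrier B" and c: "c \<in> carrier A" and u: "u \<in> carrier U" and v: "v \<in> carrier U"
  shows "sweedler2 B U (\<lambda>b\<^sub>1 b\<^sub>2. sweedler2 A U (\<lambda>c\<^sub>1 c\<^sub>2. s \<odot>\<^bsub>U\<^esub> (u \<otimes>\<^bsub>U\<^esub> (G b\<^sub>1 b\<^sub>2 c\<^sub>1 c\<^sub>2 \<otimes>\<^bsub>U\<^esub> v))) c) b =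
    s \<odot>\<^bsub>U\<^esub> (u \<otimes>\<^bsub>U\<^esub> (sweedler2 B U (\<lambda>b\<^sub>1 b\<^sub>2. sweedler2 A U (G b\<^sub>1 b\<^sub>2) c) b \<otimes>\<^bsub>U\<^esub> v))"
proof -
  note A' = coalgebra_precoalgebra[OF A] and B' = coalgebra_precoalgebra[OF B] and Z = unital_algebra_vspace[OF U]
  define h where "h = (\<lambda>x. s \<odot>\<^bsub>U\<^esub> (u \<otimes>\<^bsub>U\<^esub> (x \<otimes>\<^bsub>U\<^esub> v)))"
  have h: "linear_map U U h"
    unfolding h_def by (auto intro!: counit_intros u v)
  have "h (sweedler2 B U (\<lambda>b\<^sub>1 b\<^sub>2. sweedler2 A U (G b\<^sub>1 b\<^sub>2) c) b) =
      sweedler2 B U (\<lambda>b\<^sub>1 b\<^sub>2. h (sweedler2 A U (G b\<^sub>1 b\<^sub>2) c)) b"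
    by (rule sweedler2_commute[OF B' Z Z h]) (auto intro!: counit_intros b c)
  also have "\<dots> = sweedler2 B U (\<lambda>b\<^sub>1 b\<^sub>2. sweedler2 A U (\<lambda>c\<^sub>1 c\<^sub>2. h (G b\<^sub>1 b\<^sub>2 c\<^sub>1 c\<^sub>2)) c) b"
    by (intro sweedler2_cong[OF B' Z] sweedler2_commute[OF A' Z Z h])
      (auto intro!: counit_intros linear_map_compose[OF h] b c)
  finally show ?thesis
    by (simp add: h_def)
qed

text \<open>\<open>G\<close> abstracts the middle factor, the only part in which the legs of b and c
  meet. The innermost sum over \<open>d\<close> collapses in place; the sums over \<open>b\<close>
  and \<open>c\<close> then turn into a fixed element of \<open>U\<close>, after which the outermost
  sum over \<open>a\<close> collapses too.\<close>

lemma sweedler2_counits_left: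
  assumes a: "a \<in> carrier A" and b: "b \<in> carrier B" and c: "c \<in> carrier A" and d: "d \<in> carrier B"
  shows "sweedler2 A U (\<lambda>a\<^sub>1 a\<^sub>2. sweedler2 B U (\<lambda>b\<^sub>1 b\<^sub>2. sweedler2 A U (\<lambda>c\<^sub>1 c\<^sub>2. sweedler2 B U (\<lambda>d\<^sub>1 d\<^sub>2.
      (counit A a\<^sub>1 * counit B d\<^sub>1) \<odot>\<^bsub>U\<^esub> (f a\<^sub>2 \<otimes>\<^bsub>U\<^esub> (G b\<^sub>1 b\<^sub>2 c\<^sub>1 c\<^sub>2 \<otimes>\<^bsub>U\<^esub> g d\<^sub>2))) d) c) b) a =
    f a \<otimes>\<^bsub>U\<^esub> (sweedler2 B U (\<lambda>b\<^sub>1 b\<^sub>2. sweedler2 A U (G b\<^sub>1 b\<^sub>2) c) b \<otimes>\<^bsub>U\<^esub> g d)"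
proof -
  note A' = coalgebra_precoalgebra[OF A] and B' = coalgebra_precoalgebra[OF B] and Z = unital_algebra_vspace[OF U]
  have inner: "sweedler2 B U (\<lambda>d\<^sub>1 d\<^sub>2. (s * counit B d\<^sub>1) \<odot>\<^bsub>U\<^esub> (u \<otimes>\<^bsub>U\<^esub> (v \<otimes>\<^bsub>U\<^esub> g d\<^sub>2))) d =
      s \<odot>\<^bsub>U\<^esub> (u \<otimes>\<^bsub>U\<^esub> (v \<otimes>\<^bsub>U\<^esub> g d))" if uv: "u \<in> carrier U" "v \<in> carrier U" for s u v
  proof -
    have "sweedler2 B U (\<lambda>d\<^sub>1 d\<^sub>2. (s * counit B d\<^sub>1) \<odot>\<^bsub>U\<^esub> (u \<otimes>\<^bsub>U\<^esub> (v \<otimes>\<^bsub>U\<^esub> g d\<^sub>2))) d =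
        sweedler2 B U (\<lambda>d\<^sub>1 d\<^sub>2. counit B d\<^sub>1 \<odot>\<^bsub>U\<^esub> (s \<odot>\<^bsub>U\<^esub> (u \<otimes>\<^bsub>U\<^esub> (v \<otimes>\<^bsub>U\<^esub> g d\<^sub>2)))) d"
      by (rule sweedler2_cong[OF B' Z d])
        (auto intro!: counit_intros uv simp: vspace_smult_smult[OF Z] bilinear_map_closed[OF bilinear_map_mult[OF U]]
            linear_map_closed[OF g] uv mult.commute)
    also have "\<dots> = s \<odot>\<^bsub>U\<^esub> (u \<otimes>\<^bsub>U\<^esub> (v \<otimes>\<^bsub>U\<^esub> g d))"
      by (rule sweedler2_counit_left[OF B Z _ d]) (auto intro!: counit_intros uv)
    finally show ?thesis .
  qed
  have "sweedler2 A U (\<lambda>a\<^sub>1 a\<^sub>2. sweedler2 B U (\<lambda>b\<^sub>1 b\<^sub>2. sweedler2 A U (\<lambda>c\<^sub>1 c\<^sub>2. sweedler2 B U (\<lambda>d\<^sub>1 d\<^sub>2.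
      (counit A a\<^sub>1 * counit B d\<^sub>1) \<odot>\<^bsub>U\<^esub> (f a\<^sub>2 \<otimes>\<^bsub>U\<^esub> (G b\<^sub>1 b\<^sub>2 c\<^sub>1 c\<^sub>2 \<otimes>\<^bsub>U\<^esub> g d\<^sub>2))) d) c) b) a =
    sweedler2 A U (\<lambda>a\<^sub>1 a\<^sub>2. sweedler2 B U (\<lambda>b\<^sub>1 b\<^sub>2. sweedler2 A U (\<lambda>c\<^sub>1 c\<^sub>2.
      counit A a\<^sub>1 \<odot>\<^bsub>U\<^esub> (f a\<^sub>2 \<otimes>\<^bsub>U\<^esub> (G b\<^sub>1 b\<^sub>2 c\<^sub>1 c\<^sub>2 \<otimes>\<^bsub>U\<^esub> g d))) c) b) a"
    by (intro sweedler2_cong[OF A' Z] sweedler2_cong[OF B' Z] inner) (auto intro!: counit_intros a b c d)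
  also have "\<dots> = sweedler2 A U (\<lambda>a\<^sub>1 a\<^sub>2. counit A a\<^sub>1 \<odot>\<^bsub>U\<^esub> (f a\<^sub>2 \<otimes>\<^bsub>U\<^esub>
      (sweedler2 B U (\<lambda>b\<^sub>1 b\<^sub>2. sweedler2 A U (G b\<^sub>1 b\<^sub>2) c) b \<otimes>\<^bsub>U\<^esub> g d))) a"
    by (intro sweedler2_cong[OF A' Z] sweedler2_pull_out) (auto intro!: counit_intros a b c d)
  also have "\<dots> = f a \<otimes>\<^bsub>U\<^esub> (sweedler2 B U (\<lambda>b\<^sub>1 b\<^sub>2. sweedler2 A U (G b\<^sub>1 b\<^sub>2) c) b \<otimes>\<^bsub>U\<^esub> g d)"
    by (rule sweedler2_counit_left[OF A Z _ a]) (auto intro!: counit_intros b c d)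
  finally show ?thesis .
qed

text \<open>The mirror case for J acting from the right, where the counits sit on the second
  legs.\<close>

lemma sweedler2_counits_right:
  assumes a: "a \<in> carrier A" and b: "b \<in> carrier B" and c: "c \<in> carrier A" and d: "d \<in> carrier B"
  shows "sweedler2 A U (\<lambda>a\<^sub>1 a\<^sub>2. sweedler2 B U (\<lambda>b\<^sub>1 b\<^sub>2. sweedler2 A U (\<lambda>c\<^sub>1 c\<^sub>2. sweedler2 B U (\<lambda>d\<^sub>1 d\<^sub>2.
      (counit A a\<^sub>2 * counit B d\<^sub>2) \<odot>\<^bsub>U\<^esub> (f a\<^sub>1 \<otimes>\<^bsub>U\<^esub> (G b\<^sub>1 b\<^sub>2 c\<^sub>1 c\<^sub>2 \<otimes>\<^bsub>U\<^esub> g d\<^sub>1))) d) c) b) a =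
    f a \<otimes>\<^bsub>U\<^esub> (sweedler2 B U (\<lambda>b\<^sub>1 b\<^sub>2. sweedler2 A U (G b\<^sub>1 b\<^sub>2) c) b \<otimes>\<^bsub>U\<^esub> g d)"
proof -
  note A' = coalgebra_precoalgebra[OF A] and B' = coalgebra_precoalgebra[OF B] and Z = unital_algebra_vspace[OF U]
  have inner: "sweedler2 B U (\<lambda>d\<^sub>1 d\<^sub>2. (s * counit B d\<^sub>2) \<odot>\<^bsub>U\<^esub> (u \<otimes>\<^bsub>U\<^esub> (v \<otimes>\<^bsub>U\<^esub> g d\<^sub>1))) d =
      s \<odot>\<^bsub>U\<^esub> (u \<otimes>\<^bsub>U\<^esub> (v \<otimes>\<^bsub>U\<^esub> g d))" if uv: "u \<in> carrier U" "v \<in> carrier U" for s u v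
  proof -
    have "sweedler2 B U (\<lambda>d\<^sub>1 d\<^sub>2. (s * counit B d\<^sub>2) \<odot>\<^bsub>U\<^esub> (u \<otimes>\<^bsub>U\<^esub> (v \<otimes>\<^bsub>U\<^esub> g d\<^sub>1))) d =
        sweedler2 B U (\<lambda>d\<^sub>1 d\<^sub>2. counit B d\<^sub>2 \<odot>\<^bsub>U\<^esub> (s \<odot>\<^bsub>U\<^esub> (u \<otimes>\<^bsub>U\<^esub> (v \<otimes>\<^bsub>U\<^esub> g d\<^sub>1)))) d"
      by (rule sweedler2_cong[OF B' Z d])
        (auto intro!: counit_intros uv simp: vspace_smult_smult[OF Z] bilinear_map_closed[OF bilinear_map_mult[OF U]]
            linear_map_closed[OF g] uv mult.commute)
    also have "\<dots> = s \<odot>\<^bsub>U\<^esub> (u \<otimes>\<^bsub>U\<^esub> (v \<otimes>\<^bsub>U\<^esub> g d))"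
      by (rule sweedler2_counit_right[OF B Z _ d]) (auto intro!: counit_intros uv)
    finally show ?thesis .
  qed
  have "sweedler2 A U (\<lambda>a\<^sub>1 a\<^sub>2. sweedler2 B U (\<lambda>b\<^sub>1 b\<^sub>2. sweedler2 A U (\<lambda>c\<^sub>1 c\<^sub>2. sweedler2 B U (\<lambda>d\<^sub>1 d\<^sub>2.
      (counit A a\<^sub>2 * counit B d\<^sub>2) \<odot>\<^bsub>U\<^esub> (f a\<^sub>1 \<otimes>\<^bsub>U\<^esub> (G b\<^sub>1 b\<^sub>2 c\<^sub>1 c\<^sub>2 \<otimes>\<^bsub>U\<^esub> g d\<^sub>1))) d) c) b) a =
    sweedler2 A U (\<lambda>a\<^sub>1 a\<^sub>2. sweedler2 B U (\<lambda>b\<^sub>1 b\<^sub>2. sweedler2 A U (\<lambda>c\<^sub>1 c\<^sub>2.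
      counit A a\<^sub>2 \<odot>\<^bsub>U\<^esub> (f a\<^sub>1 \<otimes>\<^bsub>U\<^esub> (G b\<^sub>1 b\<^sub>2 c\<^sub>1 c\<^sub>2 \<otimes>\<^bsub>U\<^esub> g d))) c) b) a"
    by (intro sweedler2_cong[OF A' Z] sweedler2_cong[OF B' Z] inner) (auto intro!: counit_intros a b c d)
  also have "\<dots> = sweedler2 A U (\<lambda>a\<^sub>1 a\<^sub>2. counit A a\<^sub>2 \<odot>\<^bsub>U\<^esub> (f a\<^sub>1 \<otimes>\<^bsub>U\<^esub>
      (sweedler2 B U (\<lambda>b\<^sub>1 b\<^sub>2. sweedler2 A U (G b\<^sub>1 b\<^sub>2) c) b \<otimes>\<^bsub>U\<^esub> g d))) a"
    by (intro sweedler2_cong[OF A' Z] sweedler2_pull_out) (auto intro!: counit_intros a b c d)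
  also have "\<dots> = f a \<otimes>\<^bsub>U\<^esub> (sweedler2 B U (\<lambda>b\<^sub>1 b\<^sub>2. sweedler2 A U (G b\<^sub>1 b\<^sub>2) c) b \<otimes>\<^bsub>U\<^esub> g d)"
    by (rule sweedler2_counit_right[OF A Z _ a]) (auto intro!: counit_intros b c d)
  finally show ?thesis .
qed

end

text \<open>The product is a lift nested in a lift. The outer one can be evaluated only when the
  inner one is bilinear in the outer pair, which is linearity in parameters.\<close>

lemma bilinear_map_tensor_mult:
  assumes A: "unital_algebra A" and B: "unital_algebra B"
  shows "bilinear_map (tensor_space A B) (tensor_space A B) (tensor_space A B) (mult (tensor_algebra A B))"
    and "a \<in> carrier A \<Longrightarrow> b \<in> carrier B \<Longrightarrow> a' \<in> carrier A \<Longrightarrow> b' \<in> carrier B \<Longrightarrow>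
      tensor A B a b \<otimes>\<^bsub>tensor_algebra A B\<^esub> tensor A B a' b' = tensor A B (a \<otimes>\<^bsub>A\<^esub> a') (b \<otimes>\<^bsub>B\<^esub> b')"
proof -
  note V = unital_algebra_vspace[OF A] unital_algebra_vspace[OF B] vspace_tensor_space
  let ?S = "tensor_space A B"
  note intros = multilinear V bilinear_map_compose[OF bilinear_map_mult[OF A]]
    bilinear_map_compose[OF bilinear_map_mult[OF B]] bilinear_map_closed[OF bilinear_map_mult[OF A]]
    bilinear_map_closed[OF bilinear_map_mult[OF B]]
  have 1: "bilinear_map A B ?S (\<lambda>a' b'. tensor A B (a \<otimes>\<^bsub>A\<^esub> a') (b \<otimes>\<^bsub>B\<^esub> b'))"
    if "a \<in> carrier A" "b \<in> carrier B" for a b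
    using that by (auto intro!: intros)
  have 2: "bilinear_map A B ?S (\<lambda>a b. lift ?S (\<lambda>a' b'. tensor A B (a \<otimes>\<^bsub>A\<^esub> a') (b \<otimes>\<^bsub>B\<^esub> b')) Y)"
    if "Y \<in> carrier ?S" for Y
    using that by (intro bilinear_mapI linear_map_lift_param[OF _ V(1,2) V(3)] 1) (auto intro!: intros)
  have mult: "X \<otimes>\<^bsub>tensor_algebra A B\<^esub> Y =
      lift ?S (\<lambda>a b. lift ?S (\<lambda>a' b'. tensor A B (a \<otimes>\<^bsub>A\<^esub> a') (b \<otimes>\<^bsub>B\<^esub> b')) Y) X" for X Y
    by (simp add: tensor_algebra_def)
  show "bilinear_map ?S ?S ?S (mult (tensor_algebra A B))"
    unfolding mult
    by (intro bilinear_mapI linear_map_lift[OF V] linear_map_lift_param[OF V(3) V] 1 2)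
      (auto intro!: linear_map_lift[OF V] 1)
  show "tensor A B a b \<otimes>\<^bsub>tensor_algebra A B\<^esub> tensor A B a' b' = tensor A B (a \<otimes>\<^bsub>A\<^esub> a') (b \<otimes>\<^bsub>B\<^esub> b')"
    if "a \<in> carrier A" "b \<in> carrier B" "a' \<in> carrier A" "b' \<in> carrier B"
    using that by (simp add: mult lift_tensor[OF V] 1 2 tensor_closed)
qed

text \<open>Three lifts are nested here, over s \<otimes> t, over s and over t; each is evaluated
  after the integrand around the inner ones has been shown bilinear.\<close>

lemma leg23_tensor:
  assumes A: "precoalgebra A" and B: "precoalgebra B" and F: "linear_map (tensor_space B A) ground F"
    and "a \<in> carrier A" "b \<in> carrier B" "a' \<in> carrier A" "b' \<in> carrier B"
  shows "leg23 A B F (tensor (tensor_space A B) (tensor_space A B) (tensor A B a b) (tensor A B a' b')) =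
    counit A a * F (tensor B A b a') * counit B b'"
proof -
  note V = precoalgebra_vspace[OF A] precoalgebra_vspace[OF B]
  let ?S = "tensor_space A B"
  note intros = multilinear V vspace_ground linear_map_ground_times linear_map_compose[OF F]
    linear_map_compose[OF linear_map_counit[OF A]] linear_map_compose[OF linear_map_counit[OF B]]
  have 1: "bilinear_map A B ground (\<lambda>a' b'. counit A a * F (tensor B A b a') * counit B b')"
    if "a \<in> carrier A" "b \<in> carrier B" for a b
    using that by (auto intro!: intros)
  have 2: "bilinear_map A B ground (\<lambda>a b. lift ground (\<lambda>a' b'. counit A a * F (tensor B A b a') * counit B b') t)"
    if "t \<in> carrier ?S" for t
    using that by (intro bilinear_mapI linear_map_lift_param[OF _ V vspace_ground] 1 V) (auto intro!: intros)
  have "bilinear_map ?S ?S ground (\<lambda>s t. lift ground (\<lambda>a b. lift ground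
      (\<lambda>a' b'. counit A a * F (tensor B A b a') * counit B b') t) s)"
    by (intro bilinear_mapI linear_map_lift[OF V vspace_ground]
        linear_map_lift_param[OF vspace_tensor_space V vspace_ground] 1 2)
      (auto intro!: linear_map_lift[OF V vspace_ground] 1)
  then show ?thesis
    using assms(4-7) unfolding leg23_def
    by (simp add: lift_tensor[OF vspace_tensor_space vspace_tensor_space vspace_ground]
        lift_tensor[OF V vspace_ground] 1 2 tensor_closed)
qed

lemma mult_map_tensor_map:
  assumes V: "vspace V" and W: "vspace W" and U: "unital_algebra U"
    and f: "linear_map V U f" and g: "linear_map W U g"
  shows "linear_map (tensor_space V W) U (mult_map U \<circ> tensor_map U U f g)"
    and "x \<in> carrier V \<Longrightarrow> y \<in> carrier W \<Longrightarrow>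
      (mult_map U \<circ> tensor_map U U f g) (tensor V W x y) = f x \<otimes>\<^bsub>U\<^esub> g y"
proof -
  note Z = unital_algebra_vspace[OF U] and mU = bilinear_map_mult[OF U]
  have b: "bilinear_map V W (tensor_space U U) (\<lambda>x y. tensor U U (f x) (g y))"
    by (auto intro!: multilinear V W Z f g linear_map_closed[OF f] linear_map_closed[OF g])
  have "linear_map (tensor_space V W) (tensor_space U U) (tensor_map U U f g)"
    unfolding tensor_map_def using V W b by (intro linear_map_lift) auto
  moreover have "linear_map (tensor_space U U) U (mult_map U)"
    unfolding mult_map_def using Z mU by (intro linear_map_lift)
  ultimately show "linear_map (tensor_space V W) U (mult_map U \<circ> tensor_map U U f g)"
    unfolding o_def by (rule linear_map_compose[rotated])
  show "(mult_map U \<circ> tensor_map U U f g) (tensor V W x y) = f x \<otimes>\<^bsub>U\<^esub> g y"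
    if "x \<in> carrier V" "y \<in> carrier W"
    using that lift_tensor[OF Z Z Z mU linear_map_closed[OF f] linear_map_closed[OF g]]
    by (simp add: tensor_map_def mult_map_def lift_tensor[OF V W vspace_tensor_space b])
qed

theorem proposition2p44:
  fixes A :: "('k::field_char_0, 'a) bialg"
    and B :: "('k, 'b) bialg"
    and U :: "('k, 'u) module"
    and F :: "('k, 'b, 'a) tens \<Rightarrow> 'k"
    and \<phi>\<^sub>A :: "'a \<Rightarrow> 'u"
    and \<phi>\<^sub>B :: "'b \<Rightarrow> 'u"
  assumes "bialgebra A" and "bialgebra B"
    and "relative_dual_Drinfeld_twist A B F"
    and "unital_algebra U"
    and "algebra_hom A U \<phi>\<^sub>A" and "algebra_hom B U \<phi>\<^sub>B"
  shows "algebra_hom (twisted_algebra (tensor_bialgebra A B) (leg23 A B F)) U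
           (mult_map U \<circ> tensor_map U U \<phi>\<^sub>A \<phi>\<^sub>B) \<longleftrightarrow>
         (\<forall>a\<in>carrier A. \<forall>b\<in>carrier B.
            sweedler2 B U (\<lambda>b\<^sub>1 b\<^sub>2. sweedler2 A U (\<lambda>a\<^sub>1 a\<^sub>2.
              F (tensor B A b\<^sub>1 a\<^sub>1) \<odot>\<^bsub>U\<^esub> (\<phi>\<^sub>B b\<^sub>2 \<otimes>\<^bsub>U\<^esub> \<phi>\<^sub>A a\<^sub>2)) a) b =
            sweedler2 B U (\<lambda>b\<^sub>1 b\<^sub>2. sweedler2 A U (\<lambda>a\<^sub>1 a\<^sub>2.
              F (tensor B A b\<^sub>2 a\<^sub>2) \<odot>\<^bsub>U\<^esub> (\<phi>\<^sub>A a\<^sub>1 \<otimes>\<^bsub>U\<^esub> \<phi>\<^sub>B b\<^sub>1)) a) b)"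
proof -
  have A: "coalgebra A" "unital_algebra A" and B: "coalgebra B" "unital_algebra B"
    and U: "unital_algebra U"
    and f: "linear_map A U \<phi>\<^sub>A" "\<phi>\<^sub>A \<in> ring_hom A U" and g: "linear_map B U \<phi>\<^sub>B" "\<phi>\<^sub>B \<in> ring_hom B U"
    and F: "linear_map (tensor_space B A) ground F"
    using assms by (auto simp: bialgebra_def algebra_hom_def relative_dual_Drinfeld_twist_def)
  interpret A: ring A using A(2) by (rule unital_algebra_ring)
  interpret B: ring B using B(2) by (rule unital_algebra_ring)
  interpret U: ring U using U by (rule unital_algebra_ring)
  let ?T = "tensor_bialgebra A B"
  let ?S = "tensor_space A B"
  let ?J = "leg23 A B F"
  let ?t = "tensor A B"
  define \<phi> where "\<phi> = mult_map U \<circ> tensor_map U U \<phi>\<^sub>A \<phi>\<^sub>B"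
  define L where "L = (\<lambda>a b. sweedler2 B U (\<lambda>b\<^sub>1 b\<^sub>2. sweedler2 A U (\<lambda>a\<^sub>1 a\<^sub>2.
    F (tensor B A b\<^sub>1 a\<^sub>1) \<odot>\<^bsub>U\<^esub> (\<phi>\<^sub>B b\<^sub>2 \<otimes>\<^bsub>U\<^esub> \<phi>\<^sub>A a\<^sub>2)) a) b)"
  define R where "R = (\<lambda>a b. sweedler2 B U (\<lambda>b\<^sub>1 b\<^sub>2. sweedler2 A U (\<lambda>a\<^sub>1 a\<^sub>2.
    F (tensor B A b\<^sub>2 a\<^sub>2) \<odot>\<^bsub>U\<^esub> (\<phi>\<^sub>A a\<^sub>1 \<otimes>\<^bsub>U\<^esub> \<phi>\<^sub>B b\<^sub>1)) a) b)"
  \<comment> \<open>\<open>P\<close> and \<open>Q\<close> are the two sides supplied by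
    \<open>twisted_mult_hom_iff\<close>, kept as bilinear functions of two elements of A \<otimes> B
    so that each argument can be reduced to elementary tensors separately.\<close>
  define P where "P = (\<lambda>x y. sweedler2 ?T U (\<lambda>x\<^sub>1 x\<^sub>2. sweedler2 ?T U (\<lambda>y\<^sub>1 y\<^sub>2.
    ?J (tensor ?T ?T x\<^sub>1 y\<^sub>1) \<odot>\<^bsub>U\<^esub> (\<phi> x\<^sub>2 \<otimes>\<^bsub>U\<^esub> \<phi> y\<^sub>2)) y) x)"
  define Q where "Q = (\<lambda>x y. sweedler2 ?T U (\<lambda>x\<^sub>1 x\<^sub>2. sweedler2 ?T U (\<lambda>y\<^sub>1 y\<^sub>2.
    ?J (tensor ?T ?T x\<^sub>2 y\<^sub>2) \<odot>\<^bsub>U\<^esub> \<phi> (x\<^sub>1 \<otimes>\<^bsub>?T\<^esub> y\<^sub>1)) y) x)"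
  note A' = coalgebra_precoalgebra[OF A(1)] and B' = coalgebra_precoalgebra[OF B(1)]
  note V = precoalgebra_vspace[OF A'] precoalgebra_vspace[OF B']
  note Z = unital_algebra_vspace[OF U]
  note T' = precoalgebra_tensor_bialgebra[OF A' B']
  note \<phi> = mult_map_tensor_map(1)[OF V U f(1) g(1), folded \<phi>_def]
  note \<phi>_tensor = mult_map_tensor_map(2)[OF V U f(1) g(1), folded \<phi>_def]
  note mU = bilinear_map_mult[OF U]
  note \<mu> = bilinear_map_tensor_mult(1)[OF A(2) B(2)]
  have J: "linear_map (tensor_space ?S ?S) ground ?J"
    and J_inv: "\<exists>g. is_conv_inverse (tensor_bialgebra ?T ?T) ?J g"
    using assms(3) by (auto simp: relative_dual_Drinfeld_twist_def dual_Drinfeld_twist_def Let_def)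
  note closed = linear_map_closed[OF f(1)] linear_map_closed[OF g(1)]
  note smult = U[unfolded unital_algebra_def, THEN conjunct2, THEN conjunct2, rule_format]
    vspace_smult_smult[OF Z] vspace_smult_closed[OF Z]
  note intros = multilinear A' B' T' V Z vspace_tensor_space vspace_tensor_bialgebra
    linear_map_ground_times linear_map_compose[OF f(1)] linear_map_compose[OF g(1)]
    linear_map_compose[OF J] linear_map_compose[OF F] linear_map_compose[OF \<phi>]
    bilinear_map_compose[OF mU] bilinear_map_compose[OF \<mu>] bilinear_map_closed[OF mU] bilinear_map_closed[OF \<mu>]
    linear_map_closed[OF \<phi>] closed vspace_smult_closed[OF Z]
    linear_map_compose[OF linear_map_counit[OF A']] linear_map_compose[OF linear_map_counit[OF B']]

  have P_tensor: "P (?t a b) (?t c d) = \<phi>\<^sub>A a \<otimes>\<^bsub>U\<^esub> (L c b \<otimes>\<^bsub>U\<^esub> \<phi>\<^sub>B d)"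
    if "a \<in> carrier A" "b \<in> carrier B" "c \<in> carrier A" "d \<in> carrier B" for a b c d
  proof -
    have "P (?t a b) (?t c d) = sweedler2 A U (\<lambda>a\<^sub>1 a\<^sub>2. sweedler2 B U (\<lambda>b\<^sub>1 b\<^sub>2. sweedler2 ?T U (\<lambda>y\<^sub>1 y\<^sub>2.
        ?J (tensor ?S ?S (?t a\<^sub>1 b\<^sub>1) y\<^sub>1) \<odot>\<^bsub>U\<^esub> (\<phi> (?t a\<^sub>2 b\<^sub>2) \<otimes>\<^bsub>U\<^esub> \<phi> y\<^sub>2)) (?t c d)) b) a"
      unfolding P_def tensor_space_tensor_bialgebra
      by (rule sweedler2_tensor[OF A' B' Z]) (auto intro!: intros that)
    also have "\<dots> = sweedler2 A U (\<lambda>a\<^sub>1 a\<^sub>2. sweedler2 B U (\<lambda>b\<^sub>1 b\<^sub>2. sweedler2 A U (\<lambda>c\<^sub>1 c\<^sub>2. sweedler2 B U (\<lambda>d\<^sub>1 d\<^sub>2.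
        ?J (tensor ?S ?S (?t a\<^sub>1 b\<^sub>1) (?t c\<^sub>1 d\<^sub>1)) \<odot>\<^bsub>U\<^esub> (\<phi> (?t a\<^sub>2 b\<^sub>2) \<otimes>\<^bsub>U\<^esub> \<phi> (?t c\<^sub>2 d\<^sub>2))) d) c) b) a"
      by (intro sweedler2_cong[OF A' Z] sweedler2_cong[OF B' Z] sweedler2_tensor[OF A' B' Z])
        (auto intro!: intros that)
    \<comment> \<open>The scalar \<epsilon>(a1) F(b1,c1) \<epsilon>(d1) is distributed: the counits
      stay in front, while F moves into the middle factor, which then has the form \<open>G\<close>
      of the collapsing rule.\<close>
    also have "\<dots> = sweedler2 A U (\<lambda>a\<^sub>1 a\<^sub>2. sweedler2 B U (\<lambda>b\<^sub>1 b\<^sub>2. sweedler2 A U (\<lambda>c\<^sub>1 c\<^sub>2. sweedler2 B U (\<lambda>d\<^sub>1 d\<^sub>2.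
        (counit A a\<^sub>1 * counit B d\<^sub>1) \<odot>\<^bsub>U\<^esub> (\<phi>\<^sub>A a\<^sub>2 \<otimes>\<^bsub>U\<^esub>
          ((F (tensor B A b\<^sub>1 c\<^sub>1) \<odot>\<^bsub>U\<^esub> (\<phi>\<^sub>B b\<^sub>2 \<otimes>\<^bsub>U\<^esub> \<phi>\<^sub>A c\<^sub>2)) \<otimes>\<^bsub>U\<^esub> \<phi>\<^sub>B d\<^sub>2))) d) c) b) a"
      by (intro sweedler2_cong[OF A' Z] sweedler2_cong[OF B' Z])
        (auto intro!: intros that simp: leg23_tensor[OF A' B' F] \<phi>_tensor smult closed U.m_assoc mult_ac)
    also have "\<dots> = \<phi>\<^sub>A a \<otimes>\<^bsub>U\<^esub> (L c b \<otimes>\<^bsub>U\<^esub> \<phi>\<^sub>B d)"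
      unfolding L_def by (rule sweedler2_counits_left[OF A(1) B(1) U f(1) g(1)]) (auto intro!: intros that)
    finally show ?thesis .
  qed
  have Q_tensor: "Q (?t a b) (?t c d) = \<phi>\<^sub>A a \<otimes>\<^bsub>U\<^esub> (R c b \<otimes>\<^bsub>U\<^esub> \<phi>\<^sub>B d)"
    if "a \<in> carrier A" "b \<in> carrier B" "c \<in> carrier A" "d \<in> carrier B" for a b c d
  proof -
    have "Q (?t a b) (?t c d) = sweedler2 A U (\<lambda>a\<^sub>1 a\<^sub>2. sweedler2 B U (\<lambda>b\<^sub>1 b\<^sub>2. sweedler2 ?T U (\<lambda>y\<^sub>1 y\<^sub>2.
        ?J (tensor ?S ?S (?t a\<^sub>2 b\<^sub>2) y\<^sub>2) \<odot>\<^bsub>U\<^esub> \<phi> (?t a\<^sub>1 b\<^sub>1 \<otimes>\<^bsub>?T\<^esub> y\<^sub>1)) (?t c d)) b) a"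
      unfolding Q_def tensor_space_tensor_bialgebra
      by (rule sweedler2_tensor[OF A' B' Z]) (auto intro!: intros that)
    also have "\<dots> = sweedler2 A U (\<lambda>a\<^sub>1 a\<^sub>2. sweedler2 B U (\<lambda>b\<^sub>1 b\<^sub>2. sweedler2 A U (\<lambda>c\<^sub>1 c\<^sub>2. sweedler2 B U (\<lambda>d\<^sub>1 d\<^sub>2.
        ?J (tensor ?S ?S (?t a\<^sub>2 b\<^sub>2) (?t c\<^sub>2 d\<^sub>2)) \<odot>\<^bsub>U\<^esub> \<phi> (?t a\<^sub>1 b\<^sub>1 \<otimes>\<^bsub>?T\<^esub> ?t c\<^sub>1 d\<^sub>1)) d) c) b) a"
      by (intro sweedler2_cong[OF A' Z] sweedler2_cong[OF B' Z] sweedler2_tensor[OF A' B' Z])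
        (auto intro!: intros that)
    \<comment> \<open>Multiplicativity of \<open>\<phi>\<^sub>A\<close> and
      \<open>\<phi>\<^sub>B\<close> turns the image of a1 c1 \<otimes> b1 d1 into a product of four
      factors, and reassociation isolates the middle two, from c1 and b1.\<close>
    also have "\<dots> = sweedler2 A U (\<lambda>a\<^sub>1 a\<^sub>2. sweedler2 B U (\<lambda>b\<^sub>1 b\<^sub>2. sweedler2 A U (\<lambda>c\<^sub>1 c\<^sub>2. sweedler2 B U (\<lambda>d\<^sub>1 d\<^sub>2.
        (counit A a\<^sub>2 * counit B d\<^sub>2) \<odot>\<^bsub>U\<^esub> (\<phi>\<^sub>A a\<^sub>1 \<otimes>\<^bsub>U\<^esub>
          ((F (tensor B A b\<^sub>2 c\<^sub>2) \<odot>\<^bsub>U\<^esub> (\<phi>\<^sub>A c\<^sub>1 \<otimes>\<^bsub>U\<^esub> \<phi>\<^sub>B b\<^sub>1)) \<otimes>\<^bsub>U\<^esub> \<phi>\<^sub>B d\<^sub>1))) d) c) b) a"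
      by (intro sweedler2_cong[OF A' Z] sweedler2_cong[OF B' Z])
        (auto intro!: intros that simp: leg23_tensor[OF A' B' F] bilinear_map_tensor_mult(2)[OF A(2) B(2)]
          \<phi>_tensor ring_hom_mult[OF f(2)] ring_hom_mult[OF g(2)] smult closed U.m_assoc mult_ac)
    also have "\<dots> = \<phi>\<^sub>A a \<otimes>\<^bsub>U\<^esub> (R c b \<otimes>\<^bsub>U\<^esub> \<phi>\<^sub>B d)"
      unfolding R_def by (rule sweedler2_counits_right[OF A(1) B(1) U f(1) g(1)]) (auto intro!: intros that)
    finally show ?thesis .
  qed
  have P: "bilinear_map ?S ?S U P" and Q: "bilinear_map ?S ?S U Q"
    unfolding P_def Q_def tensor_space_tensor_bialgebra by (auto intro!: intros)
  have LR: "L a b \<in> carrier U" "R a b \<in> carrier U" if "a \<in> carrier A" "b \<in> carrier B" for a b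
    unfolding L_def R_def using that by (auto intro!: intros)

  have "algebra_hom (twisted_algebra ?T ?J) U \<phi> \<longleftrightarrow>
      (\<forall>x\<in>carrier ?T. \<forall>y\<in>carrier ?T. \<phi> (twisted_mult ?T ?J x y) = \<phi> x \<otimes>\<^bsub>U\<^esub> \<phi> y)"
  proof -
    \<comment> \<open>Twisting changes neither the vector space nor the unit 1 \<otimes> 1, so
      linearity and preservation of the unit hold for \<open>\<phi>\<close> anyway and
      multiplicativity is all that is left of \<open>algebra_hom\<close>.\<close>
    have "\<phi> (?t \<one>\<^bsub>A\<^esub> \<one>\<^bsub>B\<^esub>) = \<one>\<^bsub>U\<^esub>"
      by (simp add: \<phi>_tensor ring_hom_one[OF f(2)] ring_hom_one[OF g(2)])
    moreover have "\<one>\<^bsub>tensor_algebra A B\<^esub> = ?t \<one>\<^bsub>A\<^esub> \<one>\<^bsub>B\<^esub>"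
      by (simp add: tensor_algebra_def)
    ultimately show ?thesis
      using \<phi> by (auto simp: algebra_hom_def twisted_algebra_def linear_map_def ring_hom_def)
  qed
  also have "\<dots> \<longleftrightarrow> (\<forall>x\<in>carrier ?S. \<forall>y\<in>carrier ?S. P x y = Q x y)"
    using twisted_mult_hom_iff[OF coalgebra_tensor_bialgebra[OF A(1) B(1)] _ U, of \<phi> ?J] \<mu> \<phi> J J_inv
    by (simp add: P_def Q_def)
  also have "\<dots> \<longleftrightarrow> (\<forall>a\<in>carrier A. \<forall>b\<in>carrier B. \<forall>c\<in>carrier A. \<forall>d\<in>carrier B.
      P (?t a b) (?t c d) = Q (?t a b) (?t c d))"
  proof (intro iffI ballI)
    fix x y assume *: "\<forall>a\<in>carrier A. \<forall>b\<in>carrier B. \<forall>c\<in>carrier A. \<forall>d\<in>carrier B.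
        P (?t a b) (?t c d) = Q (?t a b) (?t c d)" and xy: "x \<in> carrier ?S" "y \<in> carrier ?S"
    show "P x y = Q x y"
    \<comment> \<open>The first argument is reduced with \<open>y\<close> fixed, then the second
      with an elementary tensor in first place.\<close>
    proof (rule linear_map_eq_on_tensors[OF bilinear_map_left[OF P] bilinear_map_left[OF Q] Z])
      fix a b assume ab: "a \<in> carrier A" "b \<in> carrier B"
      show "P (?t a b) y = Q (?t a b) y"
        by (rule linear_map_eq_on_tensors[OF bilinear_map_right[OF P] bilinear_map_right[OF Q] Z])
          (use * ab xy in \<open>auto intro: tensor_closed\<close>)
    qed (use xy in auto)
  qed (auto intro: tensor_closed)
  also have "\<dots> \<longleftrightarrow> (\<forall>a\<in>carrier A. \<forall>b\<in>carrier B. L a b = R a b)"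
  proof (intro iffI ballI)
    fix a b assume *: "\<forall>a\<in>carrier A. \<forall>b\<in>carrier B. \<forall>c\<in>carrier A. \<forall>d\<in>carrier B.
        P (?t a b) (?t c d) = Q (?t a b) (?t c d)" and ab: "a \<in> carrier A" "b \<in> carrier B"
    have "P (?t \<one>\<^bsub>A\<^esub> b) (?t a \<one>\<^bsub>B\<^esub>) = Q (?t \<one>\<^bsub>A\<^esub> b) (?t a \<one>\<^bsub>B\<^esub>)"
      using * ab by simp
    then show "L a b = R a b"
      using ab by (simp add: P_tensor Q_tensor ring_hom_one[OF f(2)] ring_hom_one[OF g(2)] LR)
  qed (simp add: P_tensor Q_tensor)
  finally show ?thesis
    by (simp add: \<phi>_def L_def R_def)
qed

end
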